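(* Let $x^\star$ be a local minimizer of (NSDP) such that Robinson's constraint qualification and the WCR property hold at $x^\star$. Then there exist Lagrange multipliers $\omega^\star\in\mathbb{S}^m_+$ and $\mu^\star\in\mathbb{R}^p$ such that the KKT conditions hold at $x^\star$ with $(\omega^\star,\mu^\star)$ and WSOC holds at $x^\star$ for this pair of multipliers, that is, $$d^\top\big(\nabla_x^2L(x^\star,\omega^\star,\mu^\star)+\sigma(x^\star,\omega^\star)\big)d\ \geq\ 0\quad\text{for every } d\in S(x^\star).$$
   Context: $\mathbb{S}^m$ is the space of real symmetric $m\times m$ matrices with inner product $\langle M,N\rangle=\mathrm{trace}(MN)$ (the same formula is used for general square matrices), and $\mathbb{S}^m_+$ is the cone of positive semidefinite matrices; $M\succeq0$ means $M\in\mathbb{S}^m_+$. Problem (NSDP): minimize $f(x)$ over $x\in\mathbb{R}^n$ subject to $g(x)\succeq0$ and $h(x)=0$, where $f:\mathbb{R}^n\to\mathbb{R}$, $g:\mathbb{R}^n\to\mathbb{S}^m$, $h:\mathbb{R}^n\to\mathbb{R}^p$ are twice continuously differentiable. $\partial_\ell g(x)\in\mathbb{S}^m$ is the partial derivative of $g$ in the $\ell$-th variable, $Dg(x)[d]=\sum_{\ell=1}^n d_\ell\,\partial_\ell g(x)$, and $Dh(x)$ is the Jacobian of $h$. Robinson's constraint qualification holds at a feasible point $x$ if $Dh(x)$ has full row rank and there is $d\in\mathbb{R}^n$ with $g(x)+Dg(x)[d]\in\mathrm{int}(\mathbb{S}^m_+)$ and $Dh(x)d=0$. The Lagrangian is $L(x,\omega,\mu)=f(x)-\langle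 g(x),\omega\rangle+\langle h(x),\mu\rangle$; $\nabla_xL$ and $\nabla_x^2L$ are its gradient and Hessian in $x$. The KKT conditions hold at a feasible $x^\star$ with Lagrange multipliers $\omega^\star\in\mathbb{S}^m_+$, $\mu^\star\in\mathbb{R}^p$ if $\nabla_xL(x^\star,\omega^\star,\mu^\star)=0$ and $\langle g(x^\star),\omega^\star\rangle=0$. Let $|\bar\beta|$ be the dimension of $\mathrm{Ker}(g(x^\star))$ and $U_{\bar\beta}\in\mathbb{R}^{m\times|\bar\beta|}$ a matrix whose columns are an orthonormal basis of $\mathrm{Ker}(g(x^\star))$ (taken from a spectral decomposition of $g(x^\star)$). It is known that there are a neighborhood $\mathcal{N}_0\subset\mathbb{S}^m$ of $g(x^\star)$ and an analytic function $\mathcal{U}_{\bar\beta}:\mathcal{N}_0\to\mathbb{R}^{m\times|\bar\beta|}$ with $\mathcal{U}_{\bar\beta}(g(x^\star))=U_{\bar\beta}$ such that, for all $M\in\mathcal{N}_0$, the columns of $\mathcal{U}_{\bar\beta}(M)$ form an orthonormal basis of the space spanned by the eigenvectors associated with the $|\bar\beta|$ smallest eigenvalues of $M$. Fix such a function, and let $\bar u_1(x),\dots,\bar u_{|\bar\beta|}(x)$ be the columns of $\mathcal{U}_{\bar\beta}(g(x))$ for $x$ near $x^\star$. WCR property at a feasible $x^\star$: there is a neighborhood $\mathcal{N}$ of $x^\star$ such that the family $\{\bar v_{ij}(x):1\le i\le j\le|\bar\beta|\}\cup\{\nabla h_i(x): i\in\{1,\dots,p\}\}$ has the same rank (dimension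 of its span) for every $x\in\mathcal{N}$, where $\bar v_{ij}(x)=[\bar u_i(x)^\top\partial_\ell g(x)\bar u_j(x)]_{\ell\in\{1,\dots,n\}}\in\mathbb{R}^n$. Sigma-term: $\sigma(x^\star,\omega^\star)=[\,2\langle\omega^\star,\partial_ig(x^\star)\,g(x^\star)^\dagger\,\partial_jg(x^\star)\rangle\,]_{i,j\in\{1,\dots,n\}}\in\mathbb{R}^{n\times n}$, where $\dagger$ denotes the Moore-Penrose pseudoinverse. Critical cone: $C(x^\star)=\{d\in\mathbb{R}^n:\nabla f(x^\star)^\top d=0,\ Dh(x^\star)d=0,\ U_{\bar\beta}^\top Dg(x^\star)[d]U_{\bar\beta}\succeq0\}$. Critical subspace: $S(x^\star)=C(x^\star)\cap(-C(x^\star))$ (the lineality space of $C(x^\star)$), which at a KKT point can be written as $S(x^\star)=\{d\in\mathbb{R}^n: Dh(x^\star)d=0,\ U_{\bar\beta}^\top Dg(x^\star)[d]U_{\bar\beta}=0\}$. *)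

theory Defs
  imports "HOL-Analysis.Analysis"
begin

section \<open>Symmetric matrices\<close>

definition sym_mats :: "(real ^ 'm ^ 'm) set" where
  "sym_mats = {M. transpose M = M}"

definition psd_cone :: "(real ^ 'm ^ 'm) set" where
  "psd_cone = {M \<in> sym_mats. \<forall>v. 0 \<le> v \<bullet> (M *v v)}"

definition mat_inner :: "real ^ 'm ^ 'm \<Rightarrow> real ^ 'm ^ 'm \<Rightarrow> real" where
  "mat_inner M N = trace (M ** N)"

definition is_pinv :: "real ^ 'm ^ 'm \<Rightarrow> real ^ 'm ^ 'm \<Rightarrow> bool" where
  "is_pinv A X \<longleftrightarrow> A ** X ** A = A \<and> X ** A ** X = X \<and>
     transpose (A ** X) = A ** X \<and> transpose (X ** A) = X ** A"

definition pinv :: "real ^ 'm ^ 'm \<Rightarrow> real ^ 'm ^ 'm" where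
  "pinv A = (THE X. is_pinv A X)"

definition mat_ker :: "real ^ 'm ^ 'm \<Rightarrow> (real ^ 'm) set" where
  "mat_ker A = {v. A *v v = 0}"

text \<open>
  The size of a matrix whose number of columns is the dimension of a kernel depends on the
  data, so such a matrix is represented by the family \<open>u 0, \<dots>, u (k - 1)\<close> of its columns,
  and a \<open>k \<times> k\<close> matrix by its entries \<open>A i j\<close> with \<open>i, j < k\<close>. Values outside
  these index ranges are irrelevant.
\<close>

definition psd_upto :: "nat \<Rightarrow> (nat \<Rightarrow> nat \<Rightarrow> real) \<Rightarrow> bool" where
  "psd_upto k A \<longleftrightarrow> (\<forall>i<k. \<forall>j<k. A i j = A j i) \<and>
     (\<forall>z :: nat \<Rightarrow> real. 0 \<le> (\<Sum>i<k. \<Sum>j<k. z i * A i j * z j))"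

definition orthonormal_basis :: "nat \<Rightarrow> (nat \<Rightarrow> real ^ 'm) \<Rightarrow> (real ^ 'm) set \<Rightarrow> bool" where
  "orthonormal_basis k u W \<longleftrightarrow>
     (\<forall>i<k. \<forall>j<k. u i \<bullet> u j = (if i = j then 1 else 0)) \<and> span (u ` {..<k}) = W"

text \<open>Eigenvalues are listed with multiplicity, in nondecreasing order.\<close>

definition spectral_decomposition ::
    "real ^ 'm ^ 'm \<Rightarrow> (nat \<Rightarrow> real) \<Rightarrow> (nat \<Rightarrow> real ^ 'm) \<Rightarrow> bool" where
  "spectral_decomposition M ev e \<longleftrightarrow>
     orthonormal_basis CARD('m) e UNIV \<and>
     (\<forall>i<CARD('m). M *v e i = ev i *\<^sub>R e i) \<and>
     (\<forall>i j. i \<le> j \<and> j < CARD('m) \<longrightarrow> ev i \<le> ev j)"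

text \<open>
  A relation rather than a function: \<open>W\<close> is uniquely determined only if the \<open>k\<close>-th smallest
  eigenvalue is strictly below the next one. This is automatic near a positive semidefinite
  matrix with \<open>k\<close>-dimensional kernel.
\<close>

definition smallest_eigenspace :: "nat \<Rightarrow> real ^ 'm ^ 'm \<Rightarrow> (real ^ 'm) set \<Rightarrow> bool" where
  "smallest_eigenspace k M W \<longleftrightarrow>
     (\<exists>ev e. spectral_decomposition M ev e \<and> W = span (e ` {..<k}))"

section \<open>Smoothness\<close>

text \<open>
  Real analyticity as local expansion into an (unconditionally convergent) power series in the
  coordinates; the multi-indices are the functions \<open>\<alpha>\<close> from \<open>Basis\<close> to \<open>nat\<close>.
  For \<open>S\<close> relatively open in a linear subspace, this is analyticity on \<open>S\<close> as an open set of
  that subspace, because the coordinates depend linearly on linear coordinates of the subspace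
  and conversely.
\<close>

definition real_analytic_on ::
    "('a::euclidean_space \<Rightarrow> 'b::euclidean_space) \<Rightarrow> 'a set \<Rightarrow> bool" where
  "real_analytic_on F S \<longleftrightarrow>
     (\<forall>x\<in>S. \<exists>r>0. \<exists>c :: ('a \<Rightarrow> nat) \<Rightarrow> 'b. \<forall>y \<in> S \<inter> ball x r.
        ((\<lambda>\<alpha>. (\<Prod>b\<in>Basis. ((y - x) \<bullet> b) ^ \<alpha> b) *\<^sub>R c \<alpha>) has_sum F y)
          (Basis \<rightarrow>\<^sub>E UNIV))"

definition twice_cont_diff :: "('a::real_normed_vector \<Rightarrow> 'b::real_normed_vector) \<Rightarrow> bool" where
  "twice_cont_diff F \<longleftrightarrow>
     (\<exists>(F' :: 'a \<Rightarrow> 'a \<Rightarrow>\<^sub>L 'b) (F'' :: 'a \<Rightarrow> 'a \<Rightarrow>\<^sub>L ('a \<Rightarrow>\<^sub>L 'b)).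
        (\<forall>x. (F has_derivative blinfun_apply (F' x)) (at x)) \<and>
        (\<forall>x. (F' has_derivative blinfun_apply (F'' x)) (at x)) \<and>
        continuous_on UNIV F'')"

definition partial_deriv :: "'n \<Rightarrow> (real ^ 'n \<Rightarrow> 'b::real_normed_vector) \<Rightarrow> real ^ 'n \<Rightarrow> 'b" where
  "partial_deriv l F x = vector_derivative (\<lambda>t. F (x + t *\<^sub>R axis l 1)) (at 0)"

definition dir_deriv :: "(real ^ 'n \<Rightarrow> 'b::real_normed_vector) \<Rightarrow> real ^ 'n \<Rightarrow> real ^ 'n \<Rightarrow> 'b" where
  "dir_deriv F x d = (\<Sum>l\<in>UNIV. (d $ l) *\<^sub>R partial_deriv l F x)"

definition grad :: "(real ^ 'n \<Rightarrow> real) \<Rightarrow> real ^ 'n \<Rightarrow> real ^ 'n" where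
  "grad F x = (\<chi> l. partial_deriv l F x)"

definition hess :: "(real ^ 'n \<Rightarrow> real) \<Rightarrow> real ^ 'n \<Rightarrow> real ^ 'n ^ 'n" where
  "hess F x = (\<chi> i j. partial_deriv i (partial_deriv j F) x)"

section \<open>Nonlinear semidefinite programming\<close>

text \<open>
  The map \<open>h\<close> into \<open>\<real>\<^sup>p\<close> is given by its components \<open>h 0, \<dots>, h (p - 1)\<close>, so that
  \<open>p = 0\<close> (no equality constraints) is allowed; likewise for the multiplier \<open>\<mu>\<close>.
\<close>

definition feasible ::
    "(real ^ 'n \<Rightarrow> real ^ 'm ^ 'm) \<Rightarrow> nat \<Rightarrow> (nat \<Rightarrow> real ^ 'n \<Rightarrow> real) \<Rightarrow> real ^ 'n \<Rightarrow> bool" where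
  "feasible g p h x \<longleftrightarrow> g x \<in> psd_cone \<and> (\<forall>i<p. h i x = 0)"

definition local_minimizer ::
    "(real ^ 'n \<Rightarrow> real) \<Rightarrow> (real ^ 'n \<Rightarrow> real ^ 'm ^ 'm) \<Rightarrow> nat \<Rightarrow>
     (nat \<Rightarrow> real ^ 'n \<Rightarrow> real) \<Rightarrow> real ^ 'n \<Rightarrow> bool" where
  "local_minimizer f g p h x \<longleftrightarrow> feasible g p h x \<and>
     (\<exists>r>0. \<forall>y\<in>ball x r. feasible g p h y \<longrightarrow> f x \<le> f y)"

text \<open>The rows of the Jacobian \<open>Dh(x)\<close> are the gradients \<open>grad (h i) x\<close>, \<open>i < p\<close>.\<close>

definition robinson_cq ::
    "(real ^ 'n \<Rightarrow> real ^ 'm ^ 'm) \<Rightarrow> nat \<Rightarrow> (nat \<Rightarrow> real ^ 'n \<Rightarrow> real) \<Rightarrow> real ^ 'n \<Rightarrow> bool" where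
  "robinson_cq g p h x \<longleftrightarrow>
     dim ((\<lambda>i. grad (h i) x) ` {..<p}) = p \<and>
     (\<exists>d. g x + dir_deriv g x d \<in> (top_of_set sym_mats) interior_of psd_cone \<and>
          (\<forall>i<p. grad (h i) x \<bullet> d = 0))"

definition lagrangian ::
    "(real ^ 'n \<Rightarrow> real) \<Rightarrow> (real ^ 'n \<Rightarrow> real ^ 'm ^ 'm) \<Rightarrow> nat \<Rightarrow>
     (nat \<Rightarrow> real ^ 'n \<Rightarrow> real) \<Rightarrow> real ^ 'm ^ 'm \<Rightarrow> (nat \<Rightarrow> real) \<Rightarrow> real ^ 'n \<Rightarrow> real" where
  "lagrangian f g p h \<omega> \<mu> x = f x - mat_inner (g x) \<omega> + (\<Sum>i<p. h i x * \<mu> i)"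

definition kkt ::
    "(real ^ 'n \<Rightarrow> real) \<Rightarrow> (real ^ 'n \<Rightarrow> real ^ 'm ^ 'm) \<Rightarrow> nat \<Rightarrow>
     (nat \<Rightarrow> real ^ 'n \<Rightarrow> real) \<Rightarrow> real ^ 'n \<Rightarrow> real ^ 'm ^ 'm \<Rightarrow> (nat \<Rightarrow> real) \<Rightarrow> bool" where
  "kkt f g p h x \<omega> \<mu> \<longleftrightarrow> feasible g p h x \<and> \<omega> \<in> psd_cone \<and>
     grad (lagrangian f g p h \<omega> \<mu>) x = 0 \<and> mat_inner (g x) \<omega> = 0"

text \<open>
  The matrix function \<open>UU\<close> on the relatively open neighbourhood \<open>N0\<close> of \<open>A\<close> in the space of
  symmetric matrices, extending the basis \<open>U\<close> of the kernel of \<open>A\<close>; \<open>UU M i\<close> is the \<open>i\<close>-th column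
  of the value at \<open>M\<close>.
\<close>

definition analytic_eigenbasis ::
    "real ^ 'm ^ 'm \<Rightarrow> nat \<Rightarrow> (nat \<Rightarrow> real ^ 'm) \<Rightarrow> (real ^ 'm ^ 'm) set \<Rightarrow>
     (real ^ 'm ^ 'm \<Rightarrow> nat \<Rightarrow> real ^ 'm) \<Rightarrow> bool" where
  "analytic_eigenbasis A b U N0 UU \<longleftrightarrow>
     openin (top_of_set sym_mats) N0 \<and> A \<in> N0 \<and>
     (\<forall>i<b. real_analytic_on (\<lambda>M. UU M i) N0) \<and>
     (\<forall>i<b. UU A i = U i) \<and>
     (\<forall>M\<in>N0. \<exists>W. smallest_eigenspace b M W \<and> orthonormal_basis b (UU M) W)"

definition vbar ::
    "(real ^ 'n \<Rightarrow> real ^ 'm ^ 'm) \<Rightarrow> (real ^ 'm ^ 'm \<Rightarrow> nat \<Rightarrow> real ^ 'm) \<Rightarrow>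
     nat \<Rightarrow> nat \<Rightarrow> real ^ 'n \<Rightarrow> real ^ 'n" where
  "vbar g UU i j x = (\<chi> l. UU (g x) i \<bullet> (partial_deriv l g x *v UU (g x) j))"

definition wcr ::
    "(real ^ 'n \<Rightarrow> real ^ 'm ^ 'm) \<Rightarrow> nat \<Rightarrow> (nat \<Rightarrow> real ^ 'n \<Rightarrow> real) \<Rightarrow> nat \<Rightarrow>
     (real ^ 'm ^ 'm) set \<Rightarrow> (real ^ 'm ^ 'm \<Rightarrow> nat \<Rightarrow> real ^ 'm) \<Rightarrow> real ^ 'n \<Rightarrow> bool" where
  "wcr g p h b N0 UU x0 \<longleftrightarrow>
     (\<exists>N r. open N \<and> x0 \<in> N \<and> g ` N \<subseteq> N0 \<and>
        (\<forall>x\<in>N. dim ({vbar g UU i j x | i j. i \<le> j \<and> j < b} \<union> {grad (h i) x | i. i < p}) = r))"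

definition sigma_term ::
    "(real ^ 'n \<Rightarrow> real ^ 'm ^ 'm) \<Rightarrow> real ^ 'n \<Rightarrow> real ^ 'm ^ 'm \<Rightarrow> real ^ 'n ^ 'n" where
  "sigma_term g x \<omega> =
     (\<chi> i j. 2 * mat_inner \<omega> (partial_deriv i g x ** pinv (g x) ** partial_deriv j g x))"

definition critical_cone ::
    "(real ^ 'n \<Rightarrow> real) \<Rightarrow> (real ^ 'n \<Rightarrow> real ^ 'm ^ 'm) \<Rightarrow> nat \<Rightarrow>
     (nat \<Rightarrow> real ^ 'n \<Rightarrow> real) \<Rightarrow> nat \<Rightarrow> (nat \<Rightarrow> real ^ 'm) \<Rightarrow> real ^ 'n \<Rightarrow> (real ^ 'n) set" where
  "critical_cone f g p h b U x =
     {d. grad f x \<bullet> d = 0 \<and> (\<forall>i<p. grad (h i) x \<bullet> d = 0) \<and>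
         psd_upto b (\<lambda>i j. U i \<bullet> (dir_deriv g x d *v U j))}"

definition critical_subspace ::
    "(real ^ 'n \<Rightarrow> real) \<Rightarrow> (real ^ 'n \<Rightarrow> real ^ 'm ^ 'm) \<Rightarrow> nat \<Rightarrow>
     (nat \<Rightarrow> real ^ 'n \<Rightarrow> real) \<Rightarrow> nat \<Rightarrow> (nat \<Rightarrow> real ^ 'm) \<Rightarrow> real ^ 'n \<Rightarrow> (real ^ 'n) set" where
  "critical_subspace f g p h b U x =
     critical_cone f g p h b U x \<inter> uminus ` critical_cone f g p h b U x"

definition wsoc ::
    "(real ^ 'n \<Rightarrow> real) \<Rightarrow> (real ^ 'n \<Rightarrow> real ^ 'm ^ 'm) \<Rightarrow> nat \<Rightarrow>
     (nat \<Rightarrow> real ^ 'n \<Rightarrow> real) \<Rightarrow> nat \<Rightarrow> (nat \<Rightarrow> real ^ 'm) \<Rightarrow> real ^ 'n \<Rightarrow>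
     real ^ 'm ^ 'm \<Rightarrow> (nat \<Rightarrow> real) \<Rightarrow> bool" where
  "wsoc f g p h b U x \<omega> \<mu> \<longleftrightarrow>
     (\<forall>d\<in>critical_subspace f g p h b U x.
        0 \<le> d \<bullet> ((hess (lagrangian f g p h \<omega> \<mu>) x + sigma_term g x \<omega>) *v d))"

end

theory Submission
  imports Defs
begin

text \<open>
  The multipliers are limits of multipliers of penalized problems. The cone constraint is
  relaxed by a slack matrix \<open>Y\<close> that ranges over the positive semidefinite cone, and
  \<open>penalized\<close> is minimized jointly in \<open>(x, Y)\<close> near \<open>(x\<^sub>0, g x\<^sub>0)\<close>. The minimizers
  \<open>(x\<^sub>k, Y\<^sub>k)\<close> converge to \<open>(x\<^sub>0, g x\<^sub>0)\<close> (\<open>penalty_minimizers_converge\<close>), and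
  \<open>\<omega>\<^sub>k = \<rho>\<^sub>k (Y\<^sub>k - g x\<^sub>k)\<close>, \<open>\<mu>\<^sub>k = \<rho>\<^sub>k h x\<^sub>k\<close> are approximate multipliers. Robinson's condition
  keeps them bounded, so that a subsequence converges to multipliers \<open>(\<omega>, \<mu>)\<close> with which the
  KKT conditions hold (\<open>multipliers_convergent_subsequence\<close>).

  The squared distance to the cone is not twice differentiable, and the slack variable is what
  replaces its second derivative. Along \<open>t \<mapsto> x\<^sub>k + t d\<close> the slack is moved by the congruence
  \<open>(I + t E)\<^sup>T Y\<^sub>k (I + t E)\<close>, which stays in the cone for every matrix \<open>E\<close>. The penalized objective
  along this curve is twice differentiable with a local minimum at \<open>t = 0\<close>. Its second derivative
  contains \<open>\<rho>\<^sub>k\<close> times the squares of \<open>Dh(x\<^sub>k) d\<close> and of \<open>D - E\<^sup>T Y\<^sub>k - Y\<^sub>k E\<close>, where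
  \<open>D = Dg(x\<^sub>k)[d]\<close>; these would be unbounded and have to vanish. Let \<open>R\<close> be the spectral projection
  of \<open>g x\<^sub>k\<close> onto all but the \<open>b\<close> smallest eigenvalues and \<open>X\<close> the inverse of \<open>g x\<^sub>k\<close> on the range
  of \<open>R\<close>. If \<open>(I - R) D (I - R) = 0\<close>, then \<open>E = X D (I - R / 2)\<close> solves \<open>E\<^sup>T Y\<^sub>k + Y\<^sub>k E = D\<close>
  (\<open>tangent_correction\<close>), and the curvature of the slack contributes exactly
  \<open>2 \<langle>\<omega>\<^sub>k, D X D\<rangle>\<close>. Since \<open>X\<close> converges to the pseudoinverse of \<open>g x\<^sub>0\<close>, this becomes the
  sigma-term in the limit.

  The directions that are admissible at \<open>x\<^sub>k\<close> are those orthogonal to all \<open>vbar g UU i j x\<^sub>k\<close> and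
  all gradients of \<open>h\<close>. The rank of this family being constant, its orthogonal complement varies
  continuously (\<open>constant_rank_orthogonal_inner_limit\<close>), so every \<open>d\<close> in the critical subspace is a
  limit of admissible \<open>d\<^sub>k\<close>. The multipliers are chosen before the direction, so one pair serves
  all \<open>d\<close>.
\<close>

section \<open>Twice continuously differentiable maps along lines\<close>

text \<open>
  The two derivatives are arguments, so that limits and inequalities below can name them; they are
  the witnesses hidden in \<open>twice_cont_diff\<close>.
\<close>

definition c2_jet :: "('a::real_normed_vector \<Rightarrow> 'b::real_normed_vector) \<Rightarrow> ('a \<Rightarrow> 'a \<Rightarrow>\<^sub>L 'b) \<Rightarrow>
    ('a \<Rightarrow> 'a \<Rightarrow>\<^sub>L ('a \<Rightarrow>\<^sub>L 'b)) \<Rightarrow> bool" where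
  "c2_jet F F' F'' \<longleftrightarrow>
     (\<forall>x. (F has_derivative blinfun_apply (F' x)) (at x)) \<and>
     (\<forall>x. (F' has_derivative blinfun_apply (F'' x)) (at x)) \<and>
     continuous_on UNIV F''"

lemma twice_cont_diff_jet: "twice_cont_diff F \<longleftrightarrow> (\<exists>F' F''. c2_jet F F' F'')"
  by (simp add: twice_cont_diff_def c2_jet_def)

lemma c2_jet_apply_derivative:
  assumes "c2_jet F F' F''"
  shows "((\<lambda>x. F' x v) has_derivative (\<lambda>u. F'' x u v)) (at x)"
  using assms unfolding c2_jet_def
  by (auto intro!: derivative_eq_intros)

lemma c2_jet_along_line:
  assumes "c2_jet F F' F''"
  shows "((\<lambda>t. F (x + t *\<^sub>R d)) has_vector_derivative F' (x + t *\<^sub>R d) d) (at t)"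
    and "((\<lambda>t. F' (x + t *\<^sub>R d) d) has_vector_derivative F'' (x + t *\<^sub>R d) d d) (at t)"
proof -
  have line: "((\<lambda>t. x + t *\<^sub>R d) has_derivative (\<lambda>s. s *\<^sub>R d)) (at t)" for t
    by (auto intro!: derivative_eq_intros)
  have 1: "(F has_derivative blinfun_apply (F' (x + t *\<^sub>R d))) (at (x + t *\<^sub>R d))"
    using assms by (simp add: c2_jet_def)
  show "((\<lambda>t. F (x + t *\<^sub>R d)) has_vector_derivative F' (x + t *\<^sub>R d) d) (at t)"
    using has_derivative_compose[OF line 1]
    by (simp add: has_vector_derivative_def blinfun.scaleR_right)
  show "((\<lambda>t. F' (x + t *\<^sub>R d) d) has_vector_derivative F'' (x + t *\<^sub>R d) d d) (at t)"
    using has_derivative_compose[OF line c2_jet_apply_derivative[OF assms]]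
    by (simp add: has_vector_derivative_def blinfun.scaleR_right blinfun.scaleR_left)
qed

lemma c2_jet_continuous:
  assumes "c2_jet F F' F''"
  shows "continuous_on UNIV F" "continuous_on UNIV F'"
  using assms unfolding c2_jet_def
  by (meson has_derivative_continuous continuous_at_imp_continuous_on)+

lemma c2_jet_tendsto:
  assumes j: "c2_jet F F' F''" and x: "(x \<longlongrightarrow> x0) Fl" and d: "(d \<longlongrightarrow> d0) Fl"
  shows "((\<lambda>k. F (x k)) \<longlongrightarrow> F x0) Fl"
    and "((\<lambda>k. F' (x k) (d k)) \<longlongrightarrow> F' x0 d0) Fl"
    and "((\<lambda>k. F'' (x k) (d k) (d k)) \<longlongrightarrow> F'' x0 d0 d0) Fl"
proof -
  have c: "isCont F x0" "isCont F' x0" "isCont F'' x0"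
    using c2_jet_continuous[OF j] j unfolding c2_jet_def
    by (simp_all add: continuous_on_eq_continuous_at)
  show "((\<lambda>k. F (x k)) \<longlongrightarrow> F x0) Fl"
    using c x by (simp add: isCont_tendsto_compose)
  have "((\<lambda>k. F' (x k)) \<longlongrightarrow> F' x0) Fl" "((\<lambda>k. F'' (x k)) \<longlongrightarrow> F'' x0) Fl"
    using c x by (simp_all add: isCont_tendsto_compose)
  then show "((\<lambda>k. F' (x k) (d k)) \<longlongrightarrow> F' x0 d0) Fl"
    and "((\<lambda>k. F'' (x k) (d k) (d k)) \<longlongrightarrow> F'' x0 d0 d0) Fl"
    using d by (auto intro!: tendsto_intros blinfun.tendsto)
qed

lemma second_order_necessary_real:
  fixes \<psi> \<psi>' :: "real \<Rightarrow> real"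
  assumes d1: "\<And>t. (\<psi> has_real_derivative \<psi>' t) (at t)"
    and d2: "(\<psi>' has_real_derivative c) (at 0)"
    and e: "\<epsilon> > 0" and min: "\<And>t. \<bar>t\<bar> < \<epsilon> \<Longrightarrow> \<psi> 0 \<le> \<psi> t"
  shows "\<psi>' 0 = 0" and "0 \<le> c"
proof -
  show z: "\<psi>' 0 = 0"
    by (rule DERIV_local_min[OF d1 e]) (use min in auto)
  show "0 \<le> c"
  proof (rule ccontr)
    assume "\<not> 0 \<le> c"
    then obtain r where r: "r > 0" "\<And>s. 0 < s \<Longrightarrow> s < r \<Longrightarrow> \<psi>' (0 + s) < \<psi>' 0"
      using DERIV_neg_dec_right[OF d2] by auto
    define s where "s = min r \<epsilon> / 2"
    have s: "0 < s" "s < r" "s < \<epsilon>" using r e by (auto simp: s_def)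
    obtain z where zz: "0 < z" "z < s" "\<psi> s - \<psi> 0 = (s - 0) * \<psi>' z"
      using MVT2[OF s(1), of \<psi> \<psi>'] d1 by auto
    have "\<psi>' z < 0" using r(2)[of z] zz s z by auto
    then have "\<psi> s < \<psi> 0" using zz(3) s(1) by (smt (verit) mult_pos_neg)
    then show False using min[of s] s by simp
  qed
qed

section \<open>Penalization with a slack variable\<close>

text \<open>
  The fourth power of the distance to \<open>x0\<close> forces minimizers towards \<open>x0\<close> although the local minimum
  need not be strict; the exponent is four because then its Hessian vanishes at \<open>x0\<close> and does not
  disturb the second-order condition in the limit. Minimizing over \<open>Y\<close> in the cone would give the
  squared distance of \<open>g x\<close> to the cone; keeping \<open>Y\<close> as a variable makes the function smooth.
\<close>

definition penalized :: "('a::real_inner \<Rightarrow> real) \<Rightarrow> ('a \<Rightarrow> 'b::real_normed_vector) \<Rightarrow> nat \<Rightarrow>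
    (nat \<Rightarrow> 'a \<Rightarrow> real) \<Rightarrow> 'a \<Rightarrow> real \<Rightarrow> 'a \<Rightarrow> 'b \<Rightarrow> real" where
  "penalized f g p h x0 \<rho> x Y =
     f x + ((x - x0) \<bullet> (x - x0))\<^sup>2 + \<rho> / 2 * ((\<Sum>i<p. (h i x)\<^sup>2) + (norm (g x - Y))\<^sup>2)"

text \<open>
  Minimize over a compact neighbourhood of \<open>(x0, g x0)\<close> with \<open>\<rho> \<rightarrow> \<infinity>\<close>. The minimal values are
  at most \<open>f x0\<close>, so a limit point is feasible, has an objective value of at least \<open>f x0\<close>, and
  therefore leaves nothing for the fourth-power term. From some index on the minimizers lie in the
  interior of the neighbourhood, where minimality is local minimality relative to \<open>K\<close> alone.
\<close>

lemma penalty_minimizers_converge: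
  fixes f :: "'a::euclidean_space \<Rightarrow> real" and g :: "'a \<Rightarrow> 'b::euclidean_space"
  assumes cf: "continuous_on UNIV f" and cg: "continuous_on UNIV g"
    and ch: "\<And>i. i < p \<Longrightarrow> continuous_on UNIV (h i)"
    and K: "closed K" and gK: "g x0 \<in> K" and h0: "\<And>i. i < p \<Longrightarrow> h i x0 = 0"
    and r: "r > 0"
    and min: "\<And>y. y \<in> ball x0 r \<Longrightarrow> g y \<in> K \<Longrightarrow> (\<And>i. i < p \<Longrightarrow> h i y = 0) \<Longrightarrow> f x0 \<le> f y"
  obtains \<rho> x Y where "\<And>k::nat. \<rho> k > 0" "\<And>k. Y k \<in> K" "\<And>k. x k \<in> ball x0 r" "x \<longlonglongrightarrow> x0" "Y \<longlonglongrightarrow> g x0"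
    "\<And>k. \<exists>\<epsilon>>0. \<forall>y\<in>ball (x k) \<epsilon>. \<forall>Z\<in>K \<inter> ball (Y k) \<epsilon>.
        penalized f g p h x0 (\<rho> k) (x k) (Y k) \<le> penalized f g p h x0 (\<rho> k) y Z"
proof -
  define C where "C = cball x0 (r / 2) \<times> (K \<inter> cball (g x0) 1)"
  define q where "q = (\<lambda>z. (\<Sum>i<p. (h i (fst z))\<^sup>2) + (norm (g (fst z) - snd z))\<^sup>2)"
  define s where "s = (\<lambda>z::'a\<times>'b. ((fst z - x0) \<bullet> (fst z - x0))\<^sup>2)"
  define \<Phi> where "\<Phi> = (\<lambda>k::nat. \<lambda>z. penalized f g p h x0 (real (Suc k)) (fst z) (snd z))"
  have \<Phi>: "\<Phi> k z = f (fst z) + s z + real (Suc k) / 2 * q z" for k z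
    by (simp add: \<Phi>_def s_def q_def penalized_def)
  have cC: "compact C"
    unfolding C_def by (intro compact_Times compact_cball closed_Int_compact K)
  have inC: "(x0, g x0) \<in> C" using gK r by (simp add: C_def)
  have cont_f: "continuous_on UNIV (\<lambda>z::'a\<times>'b. f (fst z))"
    by (intro continuous_on_compose2[OF cf] continuous_intros) auto
  have cont_q: "continuous_on UNIV q"
    unfolding q_def
    by (intro continuous_intros continuous_on_compose2[OF ch] continuous_on_compose2[OF cg]) auto
  have cont_s: "continuous_on UNIV s"
    unfolding s_def by (intro continuous_intros)
  have cont_\<Phi>: "continuous_on UNIV (\<Phi> k)" for k
    unfolding \<Phi> by (intro continuous_intros cont_f cont_q cont_s)
  have "\<exists>z\<in>C. \<forall>y\<in>C. \<Phi> k z \<le> \<Phi> k y" for k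
    by (rule continuous_attains_inf) (use cC inC continuous_on_subset[OF cont_\<Phi>] in auto)
  then obtain z where zC: "\<And>k. z k \<in> C" and zmin: "\<And>k y. y \<in> C \<Longrightarrow> \<Phi> k (z k) \<le> \<Phi> k y"
    by metis
  obtain l \<sigma> where lC: "l \<in> C" and \<sigma>: "strict_mono \<sigma>" and lim: "(z \<circ> \<sigma>) \<longlonglongrightarrow> l"
    using cC zC unfolding compact_def by metis
  have lim': "(\<lambda>k. F (z (\<sigma> k))) \<longlonglongrightarrow> F l" if "continuous_on UNIV F" for F :: "'a\<times>'b \<Rightarrow> real"
  proof (rule isCont_tendsto_compose[of l F])
    show "isCont F l" using that by (meson continuous_on_eq_continuous_at open_UNIV UNIV_I)
    show "(\<lambda>k. z (\<sigma> k)) \<longlonglongrightarrow> l" using lim by (simp add: o_def)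
  qed
  obtain m where m: "\<And>z. z \<in> C \<Longrightarrow> m \<le> f (fst z)"
    using continuous_attains_inf[OF cC _ continuous_on_subset[OF cont_f]] inC by blast
  have bd: "\<Phi> k (z k) \<le> f x0" for k
    using zmin[OF inC, of k] h0 by (simp add: \<Phi> s_def q_def)
  have q_nonneg: "0 \<le> q z" for z by (simp add: q_def sum_nonneg)
  have s_nonneg: "0 \<le> s z" for z by (simp add: s_def)
  have q_le: "q (z k) \<le> 2 * (f x0 - m) / real (Suc k)" for k
    using bd[of k] m[OF zC[of k]] s_nonneg[of "z k"] by (simp add: \<Phi> field_simps)
  have "(\<lambda>k. 2 * (f x0 - m) / real (Suc k)) \<longlonglongrightarrow> 0"
    by (intro tendsto_divide_0[OF tendsto_const] filterlim_compose[OF filterlim_real_sequentially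
         filterlim_Suc] filterlim_mono[OF _ at_top_le_at_infinity order_refl] )
  then have "(\<lambda>k. 2 * (f x0 - m) / real (Suc (\<sigma> k))) \<longlonglongrightarrow> 0"
    using LIMSEQ_subseq_LIMSEQ[OF _ \<sigma>] by (auto simp: o_def)
  then have "q l \<le> 0"
    using LIMSEQ_le[OF lim'[OF cont_q]] q_le by blast
  then have "(\<Sum>i<p. (h i (fst l))\<^sup>2) = 0 \<and> (norm (g (fst l) - snd l))\<^sup>2 = 0"
    unfolding q_def by (smt (verit) sum_nonneg zero_le_power2)
  then have feas: "\<And>i. i < p \<Longrightarrow> h i (fst l) = 0" "g (fst l) = snd l"
    by (auto simp: sum_nonneg_eq_0_iff)
  have "fst l \<in> ball x0 r" "g (fst l) \<in> K" using lC r feas(2) by (auto simp: C_def)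
  then have "f x0 \<le> f (fst l)" using min feas(1) by blast
  moreover have "f (fst (z k)) + s (z k) \<le> f x0" for k
  proof -
    have "0 \<le> real (Suc k) / 2 * q (z k)"
      using q_nonneg by (intro mult_nonneg_nonneg) auto
    then show ?thesis using bd[of k, unfolded \<Phi>] by linarith
  qed
  then have "f (fst l) + s l \<le> f x0"
    using LIMSEQ_le_const2[OF lim'[OF continuous_on_add[OF cont_f cont_s]]] by blast
  ultimately have "s l = 0" using s_nonneg[of l] by linarith
  then have l1: "fst l = x0" by (simp add: s_def)
  with feas have l2: "snd l = g x0" by simp
  have "eventually (\<lambda>k. z (\<sigma> k) \<in> ball x0 (r/2) \<times> ball (g x0) 1) sequentially"
    using lim by (intro topological_tendstoD[where l = l]) 
      (use r l1 l2 in \<open>auto simp: o_def open_Times mem_Times_iff\<close>)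
  then obtain k0 where k0: "\<And>k. k \<ge> k0 \<Longrightarrow> z (\<sigma> k) \<in> ball x0 (r/2) \<times> ball (g x0) 1"
    by (auto simp: eventually_sequentially)
  define \<tau> where "\<tau> = (\<lambda>k. \<sigma> (k + k0))"
  have lim\<tau>: "(\<lambda>k. z (\<tau> k)) \<longlonglongrightarrow> l"
    using LIMSEQ_ignore_initial_segment[OF lim, of k0] by (simp add: \<tau>_def o_def)
  show thesis
  proof (rule that[of "\<lambda>k. real (Suc (\<tau> k))" "\<lambda>k. snd (z (\<tau> k))" "\<lambda>k. fst (z (\<tau> k))"])
    show "(\<lambda>k. fst (z (\<tau> k))) \<longlonglongrightarrow> x0" "(\<lambda>k. snd (z (\<tau> k))) \<longlonglongrightarrow> g x0"
      using tendsto_fst[OF lim\<tau>] tendsto_snd[OF lim\<tau>] l1 l2 by auto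
    show "snd (z (\<tau> k)) \<in> K" "fst (z (\<tau> k)) \<in> ball x0 r" for k
      using zC[of "\<tau> k"] r by (auto simp: C_def mem_Times_iff)
    fix k
    have "z (\<tau> k) \<in> ball x0 (r/2) \<times> ball (g x0) 1" using k0 by (simp add: \<tau>_def)
    then have "fst (z (\<tau> k)) \<in> ball x0 (r/2)" "snd (z (\<tau> k)) \<in> ball (g x0) 1"
      by (auto simp: mem_Times_iff)
    then obtain e1 e2 where e: "e1 > 0" "ball (fst (z (\<tau> k))) e1 \<subseteq> ball x0 (r/2)"
        "e2 > 0" "ball (snd (z (\<tau> k))) e2 \<subseteq> ball (g x0) 1"
      by (meson open_ball open_contains_ball)
    show "\<exists>\<epsilon>>0. \<forall>y\<in>ball (fst (z (\<tau> k))) \<epsilon>. \<forall>Z\<in>K \<inter> ball (snd (z (\<tau> k))) \<epsilon>.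
        penalized f g p h x0 (real (Suc (\<tau> k))) (fst (z (\<tau> k))) (snd (z (\<tau> k)))
        \<le> penalized f g p h x0 (real (Suc (\<tau> k))) y Z"
    proof (intro exI[of _ "min e1 e2"] conjI ballI)
      fix y Z assume "y \<in> ball (fst (z (\<tau> k))) (min e1 e2)"
        "Z \<in> K \<inter> ball (snd (z (\<tau> k))) (min e1 e2)"
      then have "y \<in> ball x0 (r/2)" "Z \<in> ball (g x0) 1" "Z \<in> K" using e by auto
      then have "(y, Z) \<in> C" by (auto simp: C_def)
      from zmin[OF this] show "penalized f g p h x0 (real (Suc (\<tau> k))) (fst (z (\<tau> k))) (snd (z (\<tau> k)))
        \<le> penalized f g p h x0 (real (Suc (\<tau> k))) y Z" by (simp add: \<Phi>_def)
    qed (use e in auto)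
  qed auto
qed

text \<open>
  Quadratic curves \<open>Y + t P + t\<^sup>2 Q\<close> of slack variables suffice: \<open>P\<close> cancels the first-order change
  of \<open>g\<close>, and \<open>Q\<close> is the curvature that enters the second derivative, multiplied by \<open>\<omega>\<close>.
\<close>

lemma penalized_optimality_along_curve:
  fixes g :: "'a::real_inner \<Rightarrow> 'b::real_inner"
  assumes jf: "c2_jet f f1 f2" and jg: "c2_jet g g1 g2"
    and jh: "\<And>i. i < p \<Longrightarrow> c2_jet (h i) (h1 i) (h2 i)"
    and loc: "\<exists>\<epsilon>>0. \<forall>y\<in>ball x \<epsilon>. \<forall>Z\<in>K \<inter> ball Y \<epsilon>.
        penalized f g p h x0 \<rho> x Y \<le> penalized f g p h x0 \<rho> y Z"
    and curve: "\<And>t. Y + t *\<^sub>R P + t\<^sup>2 *\<^sub>R Q \<in> K"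
  defines "\<omega> \<equiv> \<rho> *\<^sub>R (Y - g x)" and "\<mu> \<equiv> \<lambda>i. \<rho> * h i x"
  shows "f1 x d + 4 * ((x - x0) \<bullet> (x - x0)) * ((x - x0) \<bullet> d) + (\<Sum>i<p. \<mu> i * h1 i x d)
           - \<omega> \<bullet> (g1 x d - P) = 0" (is ?first)
    and "0 \<le> f2 x d d + 8 * ((x - x0) \<bullet> d)\<^sup>2 + 4 * ((x - x0) \<bullet> (x - x0)) * (d \<bullet> d)
           + (\<Sum>i<p. \<mu> i * h2 i x d d + \<rho> * (h1 i x d)\<^sup>2)
           - \<omega> \<bullet> (g2 x d d - 2 *\<^sub>R Q) + \<rho> * (norm (g1 x d - P))\<^sup>2" (is ?second)
proof -
  obtain \<epsilon> where e: "\<epsilon> > 0" and min: "\<And>y Z. y \<in> ball x \<epsilon> \<Longrightarrow> Z \<in> K \<Longrightarrow> Z \<in> ball Y \<epsilon> \<Longrightarrow>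
        penalized f g p h x0 \<rho> x Y \<le> penalized f g p h x0 \<rho> y Z"
    using loc by auto
  define c where "c = (\<lambda>t. x + t *\<^sub>R d)"
  define w where "w = (\<lambda>t. g (c t) - (Y + t *\<^sub>R P + t\<^sup>2 *\<^sub>R Q))"
  define w' where "w' = (\<lambda>t. g1 (c t) d - (P + (2 * t) *\<^sub>R Q))"
  define \<psi> where "\<psi> = (\<lambda>t. f (c t) + ((c t - x0) \<bullet> (c t - x0))\<^sup>2 + \<rho> / 2 * ((\<Sum>i<p. (h i (c t))\<^sup>2) + w t \<bullet> w t))"
  define \<psi>' where "\<psi>' = (\<lambda>t. f1 (c t) d + 4 * ((c t - x0) \<bullet> (c t - x0)) * ((c t - x0) \<bullet> d)
      + \<rho> * ((\<Sum>i<p. h i (c t) * h1 i (c t) d) + w t \<bullet> w' t))"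
  have c0: "c 0 = x" and w0: "w 0 = g x - Y" and w'0: "w' 0 = g1 x d - P"
    by (auto simp: c_def w_def w'_def)
  have dc: "(c has_vector_derivative d) (at t)" for t
    unfolding c_def has_vector_derivative_def by (auto intro!: derivative_eq_intros)
  have df: "((\<lambda>t. f (c t)) has_real_derivative f1 (c t) d) (at t)" for t
    using c2_jet_along_line(1)[OF jf] by (simp add: c_def has_real_derivative_iff_has_vector_derivative)
  have df1: "((\<lambda>t. f1 (c t) d) has_real_derivative f2 (c t) d d) (at t)" for t
    using c2_jet_along_line(2)[OF jf] by (simp add: c_def has_real_derivative_iff_has_vector_derivative)
  have dh: "((\<lambda>t. h i (c t)) has_real_derivative h1 i (c t) d) (at t)" if "i < p" for t i
    using c2_jet_along_line(1)[OF jh[OF that]] by (simp add: c_def has_real_derivative_iff_has_vector_derivative)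
  have dh1: "((\<lambda>t. h1 i (c t) d) has_real_derivative h2 i (c t) d d) (at t)" if "i < p" for t i
    using c2_jet_along_line(2)[OF jh[OF that]] by (simp add: c_def has_real_derivative_iff_has_vector_derivative)
  have dw: "(w has_vector_derivative w' t) (at t)" for t
    using c2_jet_along_line(1)[OF jg, of x d t] unfolding w_def w'_def c_def
    by (auto intro!: derivative_eq_intros simp: power2_eq_square)
  have dw': "(w' has_vector_derivative (g2 x d d - 2 *\<^sub>R Q)) (at 0)"
    using c2_jet_along_line(2)[OF jg, of x d 0] unfolding w'_def c_def
    by (auto intro!: derivative_eq_intros)
  have inner_d: "((\<lambda>t. u t \<bullet> v t) has_real_derivative u t \<bullet> v' + u' \<bullet> v t) (at t)"
    if "(u has_vector_derivative u') (at t)" "(v has_vector_derivative v') (at t)"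
    for u v :: "real \<Rightarrow> 'z::real_inner" and u' v' t
    unfolding has_field_derivative_def
    by (rule has_derivative_eq_rhs[OF has_derivative_inner[OF that[unfolded has_vector_derivative_def]]])
       (simp add: fun_eq_iff algebra_simps)
  have dcx: "((\<lambda>t. c t - x0) has_vector_derivative d) (at t)" for t
    using dc by (auto intro!: derivative_eq_intros)
  have dn: "((\<lambda>t. (c t - x0) \<bullet> (c t - x0)) has_real_derivative 2 * ((c t - x0) \<bullet> d)) (at t)" for t
    using inner_d[OF dcx dcx, of t] by (simp add: inner_commute)
  have dl: "((\<lambda>t. (c t - x0) \<bullet> d) has_real_derivative (d \<bullet> d)) (at t)" for t
    using inner_d[OF dcx has_vector_derivative_const, of d t] by simp
  have dww: "((\<lambda>t. w t \<bullet> w t) has_real_derivative 2 * (w t \<bullet> w' t)) (at t)" for t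
    using inner_d[OF dw dw, of t] by (simp add: inner_commute)
  have dww': "((\<lambda>t. w t \<bullet> w' t) has_real_derivative w 0 \<bullet> (g2 x d d - 2 *\<^sub>R Q) + w' 0 \<bullet> w' 0) (at 0)"
    by (rule inner_d[OF dw dw'])
  have D1: "(\<psi> has_real_derivative \<psi>' t) (at t)" for t
    unfolding \<psi>_def \<psi>'_def
    by (rule df dn dww dh derivative_eq_intros refl | simp add: sum_distrib_left algebra_simps)+
  have D2: "(\<psi>' has_real_derivative
      f2 x d d + (4 * (2 * ((x - x0) \<bullet> d)) * ((x - x0) \<bullet> d) + 4 * ((x - x0) \<bullet> (x - x0)) * (d \<bullet> d))
      + \<rho> * ((\<Sum>i<p. h1 i x d * h1 i x d + h i x * h2 i x d d)
          + (w 0 \<bullet> (g2 x d d - 2 *\<^sub>R Q) + w' 0 \<bullet> w' 0))) (at 0)"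
    unfolding \<psi>'_def
    by (rule df1 dn dl dww' dh dh1 derivative_eq_intros refl | simp add: c0 algebra_simps)+
  have "eventually (\<lambda>t. c t \<in> ball x \<epsilon> \<and> Y + t *\<^sub>R P + t\<^sup>2 *\<^sub>R Q \<in> ball Y \<epsilon>) (at 0)"
  proof (intro eventually_conj topological_tendstoD[OF _ open_ball])
    show "(c \<longlongrightarrow> x) (at 0)" unfolding c_def by (auto intro!: tendsto_eq_intros)
    show "((\<lambda>t. Y + t *\<^sub>R P + t\<^sup>2 *\<^sub>R Q) \<longlongrightarrow> Y) (at 0)" by (auto intro!: tendsto_eq_intros)
  qed (use e in auto)
  then obtain r where r: "r > 0" "\<And>t. t \<noteq> 0 \<Longrightarrow> \<bar>t\<bar> < r \<Longrightarrow> c t \<in> ball x \<epsilon> \<and> Y + t *\<^sub>R P + t\<^sup>2 *\<^sub>R Q \<in> ball Y \<epsilon>"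
    unfolding eventually_at by (auto simp: dist_real_def)
  have pen: "\<psi> t = penalized f g p h x0 \<rho> (c t) (Y + t *\<^sub>R P + t\<^sup>2 *\<^sub>R Q)" for t
    by (simp add: \<psi>_def penalized_def w_def power2_norm_eq_inner)
  have "\<psi> 0 \<le> \<psi> t" if "\<bar>t\<bar> < r" for t
  proof (cases "t = 0")
    case False
    then show ?thesis using r(2)[OF False that] min[OF _ curve[of t]] unfolding pen by (simp add: c0)
  qed simp
  note res = second_order_necessary_real[OF D1 D2 r(1) this]
  have wm: "\<rho> * (w 0 \<bullet> v) = - (\<omega> \<bullet> v)" for v
    by (simp add: w0 \<omega>_def inner_diff_left algebra_simps)
  show ?first
    using res(1) wm[of "w' 0"] by (simp add: \<psi>'_def c0 w'0 \<mu>_def algebra_simps sum_distrib_left)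
  have n: "(norm (g1 x d - P))\<^sup>2 = w' 0 \<bullet> w' 0"
    by (simp add: w'0 power2_norm_eq_inner)
  have S: "(\<Sum>i<p. \<mu> i * h2 i x d d + \<rho> * (h1 i x d)\<^sup>2)
      = \<rho> * (\<Sum>i<p. h1 i x d * h1 i x d + h i x * h2 i x d d)"
    by (simp add: \<mu>_def sum_distrib_left algebra_simps power2_eq_square)
  have sq: "4 * (2 * ((x - x0) \<bullet> d)) * ((x - x0) \<bullet> d) = 8 * ((x - x0) \<bullet> d)\<^sup>2"
    by (simp add: power2_eq_square)
  show ?second
    using res(2) wm[of "g2 x d d - 2 *\<^sub>R Q"] unfolding n S sq distrib_left by linarith
qed

section \<open>Matrices and the trace inner product\<close>

lemma matrix_eqI_basis:
  fixes A B :: "real ^ 'm ^ 'k"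
  assumes "span S = UNIV" "\<And>v. v \<in> S \<Longrightarrow> A *v v = B *v v"
  shows "A = B"
proof -
  have "A *v v = B *v v" for v
    using linear_eq_on[of "(*v) A" "(*v) B" v S] assms by auto
  then show ?thesis by (simp add: matrix_eq)
qed

lemma inner_matrix_mult_left:
  fixes A :: "real ^ 'k ^ 'm" and B :: "real ^ 'n ^ 'k"
  shows "C \<bullet> (A ** B) = (transpose A ** C) \<bullet> B"
proof -
  have "C \<bullet> (A ** B) = (\<Sum>i\<in>UNIV. \<Sum>j\<in>UNIV. \<Sum>k\<in>UNIV. C $ i $ j * (A $ i $ k * B $ k $ j))"
    by (simp add: inner_vec_def matrix_matrix_mult_def sum_distrib_left)
  also have "\<dots> = (\<Sum>k\<in>UNIV. \<Sum>j\<in>UNIV. \<Sum>i\<in>UNIV. C $ i $ j * (A $ i $ k * B $ k $ j))"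
  proof -
    have "(\<Sum>i\<in>UNIV. \<Sum>j\<in>UNIV. \<Sum>k\<in>UNIV. C $ i $ j * (A $ i $ k * B $ k $ j))
      = (\<Sum>i\<in>UNIV. \<Sum>k\<in>UNIV. \<Sum>j\<in>UNIV. C $ i $ j * (A $ i $ k * B $ k $ j))"
      by (intro sum.cong refl sum.swap)
    also have "\<dots> = (\<Sum>k\<in>UNIV. \<Sum>i\<in>UNIV. \<Sum>j\<in>UNIV. C $ i $ j * (A $ i $ k * B $ k $ j))"
      by (rule sum.swap)
    also have "\<dots> = (\<Sum>k\<in>UNIV. \<Sum>j\<in>UNIV. \<Sum>i\<in>UNIV. C $ i $ j * (A $ i $ k * B $ k $ j))"
      by (intro sum.cong refl sum.swap)
    finally show ?thesis .
  qed
  also have "\<dots> = (transpose A ** C) \<bullet> B"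
    by (simp add: inner_vec_def matrix_matrix_mult_def transpose_def sum_distrib_left algebra_simps)
  finally show ?thesis .
qed

lemma inner_transpose: "transpose A \<bullet> transpose B = A \<bullet> (B :: real ^ 'n ^ 'm)"
  by (simp add: inner_vec_def transpose_def) (rule sum.swap)

lemma inner_matrix_mult_right:
  fixes A :: "real ^ 'k ^ 'm" and B :: "real ^ 'n ^ 'k"
  shows "C \<bullet> (A ** B) = (C ** transpose B) \<bullet> A"
proof -
  have "C \<bullet> (A ** B) = transpose C \<bullet> (transpose B ** transpose A)"
    by (metis inner_transpose matrix_transpose_mul)
  also have "\<dots> = (C ** transpose B) \<bullet> A"
    by (metis inner_matrix_mult_left inner_transpose matrix_transpose_mul transpose_transpose)
  finally show ?thesis .
qed

lemma mat_inner_eq: "mat_inner M N = transpose M \<bullet> N"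
  by (simp add: mat_inner_def trace_def matrix_matrix_mult_def inner_vec_def transpose_def)
     (rule sum.swap)

lemma bounded_bilinear_matrix_mult:
  "bounded_bilinear ((**) :: real ^ 'k ^ 'm \<Rightarrow> real ^ 'n ^ 'k \<Rightarrow> real ^ 'n ^ 'm)"
  by (subst bilinear_conv_bounded_bilinear[symmetric])
     (simp add: bilinear_def linear_iff vec_eq_iff matrix_matrix_mult_def
       sum.distrib algebra_simps sum_distrib_left)

lemma bounded_bilinear_matrix_vector_mult:
  "bounded_bilinear ((*v) :: real ^ 'k ^ 'm \<Rightarrow> real ^ 'k \<Rightarrow> real ^ 'm)"
  by (subst bilinear_conv_bounded_bilinear[symmetric])
     (auto simp: bilinear_def linear_iff algebra_simps scaleR_matrix_vector_assoc)

interpretation matrix_mult: bounded_bilinear "(**) :: real ^ 'k ^ 'm \<Rightarrow> real ^ 'n ^ 'k \<Rightarrow> real ^ 'n ^ 'm"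
  by (rule bounded_bilinear_matrix_mult)

interpretation matrix_vector_mult: bounded_bilinear "(*v) :: real ^ 'k ^ 'm \<Rightarrow> real ^ 'k \<Rightarrow> real ^ 'm"
  by (rule bounded_bilinear_matrix_vector_mult)

lemma linear_transpose: "linear (transpose :: real ^ 'n ^ 'm \<Rightarrow> real ^ 'm ^ 'n)"
  by (auto simp: linear_iff transpose_def vec_eq_iff)

lemma symmetric_inner_swap:
  fixes A :: "real ^ 'm ^ 'm"
  assumes "A \<in> sym_mats"
  shows "v \<bullet> (A *v w) = (A *v v) \<bullet> w"
  using assms dot_lmul_matrix[of v A w] transpose_matrix_vector[of A v] by (simp add: sym_mats_def)

lemma subspace_sym_mats: "subspace sym_mats"
  by (simp add: subspace_def sym_mats_def transpose_scalar transpose_def vec_eq_iff)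

lemma closed_sym_mats: "closed (sym_mats :: (real ^ 'm ^ 'm) set)"
  by (rule closed_subspace[OF subspace_sym_mats])

lemma derivative_in_sym_mats:
  fixes g :: "'a::real_normed_vector \<Rightarrow> real ^ 'm ^ 'm"
  assumes "(g has_derivative g') (at x)" and "\<And>y. g y \<in> sym_mats"
  shows "g' d \<in> sym_mats"
proof -
  have "bounded_linear (transpose :: real ^ 'm ^ 'm \<Rightarrow> real ^ 'm ^ 'm)"
    using linear_transpose by (simp add: linear_conv_bounded_linear)
  from bounded_linear.has_derivative[OF this assms(1)]
  have "((\<lambda>y. transpose (g y)) has_derivative (\<lambda>d. transpose (g' d))) (at x)" .
  moreover have "(\<lambda>y. transpose (g y)) = g" using assms(2) by (simp add: sym_mats_def)
  ultimately have "(g has_derivative (\<lambda>d. transpose (g' d))) (at x)" by simp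
  from has_derivative_unique[OF this assms(1)] show ?thesis
    by (simp add: sym_mats_def fun_eq_iff)
qed

lemma closed_psd_cone: "closed (psd_cone :: (real ^ 'm ^ 'm) set)"
proof -
  have "psd_cone = sym_mats \<inter> (\<Inter>v. {M :: real ^ 'm ^ 'm. 0 \<le> v \<bullet> (M *v v)})"
    by (auto simp: psd_cone_def)
  moreover have "closed {M :: real ^ 'm ^ 'm. 0 \<le> v \<bullet> (M *v v)}" for v
    by (intro closed_Collect_le continuous_intros matrix_vector_mult.continuous_on)
  ultimately show ?thesis
    using closed_sym_mats by (metis (no_types, lifting) closed_INT closed_Int)
qed

lemma psd_congruence:
  fixes Y C :: "real ^ 'm ^ 'm"
  assumes "Y \<in> psd_cone"
  shows "transpose C ** Y ** C \<in> psd_cone"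
proof -
  have "v \<bullet> ((transpose C ** Y ** C) *v v) = (C *v v) \<bullet> (Y *v (C *v v))" for v
    by (metis dot_lmul_matrix matrix_vector_mul_assoc transpose_matrix_vector transpose_transpose)
  then show ?thesis
    using assms by (auto simp: psd_cone_def sym_mats_def matrix_transpose_mul matrix_mul_assoc)
qed

lemma bilinear_vanishes_on_spans:
  fixes D :: "real ^ 'm ^ 'm"
  assumes "\<And>u v. u \<in> S \<Longrightarrow> v \<in> S \<Longrightarrow> u \<bullet> (D *v v) = 0" "u \<in> span S" "v \<in> span S"
  shows "u \<bullet> (D *v v) = 0"
proof -
  have 1: "u \<bullet> (D *v v) = 0" if "u \<in> S" "v \<in> span S" for u v
    using that(2)
  proof (induction rule: span_induct)
    case base
    show ?case by (auto simp: subspace_def algebra_simps inner_add_right matrix_vector_mult.zero_right)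
  qed (use assms(1) that(1) in auto)
  show ?thesis using assms(2)
  proof (induction rule: span_induct)
    case base
    show ?case by (auto simp: subspace_def inner_add_left)
  qed (use 1 assms(3) in auto)
qed

definition outer :: "real ^ 'm \<Rightarrow> real ^ 'n \<Rightarrow> real ^ 'n ^ 'm" where
  "outer v w = (\<chi> i j. v $ i * w $ j)"

lemma outer_mult_vec: "outer v w *v z = (w \<bullet> z) *\<^sub>R v"
  by (simp add: outer_def matrix_vector_mult_def vec_eq_iff inner_vec_def sum_distrib_right sum_distrib_left mult_ac)

lemma transpose_outer: "transpose (outer v w) = outer w v"
  by (simp add: outer_def transpose_def vec_eq_iff)

lemma inner_outer: "outer v w \<bullet> M = v \<bullet> (M *v w)"
  by (simp add: outer_def inner_vec_def matrix_vector_mult_def sum_distrib_left mult_ac)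

lemma tendsto_outer:
  assumes "(v \<longlongrightarrow> v0) F" "(w \<longlongrightarrow> w0) F"
  shows "((\<lambda>k. outer (v k) (w k)) \<longlongrightarrow> outer v0 w0) F"
proof (intro vec_tendstoI)
  fix i j
  show "((\<lambda>k. outer (v k) (w k) $ i $ j) \<longlongrightarrow> outer v0 w0 $ i $ j) F"
    using tendsto_mult[OF tendsto_vec_nth[OF assms(1)] tendsto_vec_nth[OF assms(2)], of i j]
    by (simp add: outer_def)
qed

section \<open>Spectral calculus\<close>

text \<open>
  The matrix that acts as \<open>c i\<close> on \<open>e i\<close>. For a fixed orthonormal basis \<open>e\<close> these matrices form a
  commutative algebra with pointwise operations in \<open>c\<close>, which contains all functions of a matrix
  with eigenvectors \<open>e\<close>.
\<close>

definition spectral_matrix :: "(nat \<Rightarrow> real ^ 'm) \<Rightarrow> (nat \<Rightarrow> real) \<Rightarrow> real ^ 'm ^ 'm" where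
  "spectral_matrix e c = (\<Sum>i<CARD('m). c i *\<^sub>R outer (e i) (e i))"

lemma transpose_spectral_matrix: "transpose (spectral_matrix e c) = spectral_matrix e c"
  unfolding spectral_matrix_def by (simp add: linear_sum[OF linear_transpose] transpose_scalar transpose_outer)

lemma inner_spectral_matrix:
  fixes M :: "real ^ 'm ^ 'm"
  shows "spectral_matrix e c \<bullet> M = (\<Sum>i<CARD('m). c i * (e i \<bullet> (M *v e i)))"
  by (simp add: spectral_matrix_def inner_sum_left inner_outer)

lemma tendsto_spectral_matrix:
  fixes e :: "nat \<Rightarrow> nat \<Rightarrow> real ^ 'm"
  assumes "\<And>i. i < CARD('m) \<Longrightarrow> (\<lambda>k. e k i) \<longlonglongrightarrow> l i" "\<And>i. i < CARD('m) \<Longrightarrow> (\<lambda>k. c k i) \<longlonglongrightarrow> c0 i"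
  shows "(\<lambda>k. spectral_matrix (e k) (c k)) \<longlonglongrightarrow> spectral_matrix l c0"
  unfolding spectral_matrix_def by (intro tendsto_sum tendsto_scaleR tendsto_outer assms) auto

lemma orthonormal_basis_inner:
  assumes "orthonormal_basis k u W" "i < k" "j < k"
  shows "u i \<bullet> u j = (if i = j then 1 else 0)"
  using assms by (simp add: orthonormal_basis_def)

lemma spectral_matrix_mult_basis:
  fixes e :: "nat \<Rightarrow> real ^ 'm"
  assumes e: "orthonormal_basis CARD('m) e UNIV" and j: "j < CARD('m)"
  shows "spectral_matrix e c *v e j = c j *\<^sub>R e j"
proof -
  have "spectral_matrix e c *v e j = (\<Sum>i<CARD('m). c i *\<^sub>R ((e i \<bullet> e j) *\<^sub>R e i))"
    by (simp add: spectral_matrix_def matrix_vector_mult.sum_left scaleR_matrix_vector_assoc[symmetric] outer_mult_vec)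
  also have "\<dots> = (\<Sum>i<CARD('m). if i = j then c i *\<^sub>R e i else 0)"
    using orthonormal_basis_inner[OF e _ j] by (intro sum.cong) auto
  finally show ?thesis using j by simp
qed

lemma spectral_matrix_mult_vec: "spectral_matrix e c *v v = (\<Sum>i<CARD('m). (c i * (e i \<bullet> v)) *\<^sub>R e i)"
  for v :: "real ^ 'm"
  by (simp add: spectral_matrix_def matrix_vector_mult.sum_left scaleR_matrix_vector_assoc[symmetric] outer_mult_vec)

lemma matrix_eqI_orthonormal:
  fixes e :: "nat \<Rightarrow> real ^ 'm" and A B :: "real ^ 'm ^ 'k"
  assumes e: "orthonormal_basis CARD('m) e UNIV"
    and "\<And>j. j < CARD('m) \<Longrightarrow> A *v e j = B *v e j"
  shows "A = B"
  by (rule matrix_eqI_basis[of "e ` {..<CARD('m)}"]) (use assms in \<open>auto simp: orthonormal_basis_def\<close>)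

lemma eq_spectral_matrix:
  fixes e :: "nat \<Rightarrow> real ^ 'm"
  assumes e: "orthonormal_basis CARD('m) e UNIV"
    and "\<And>j. j < CARD('m) \<Longrightarrow> A *v e j = c j *\<^sub>R e j"
  shows "A = spectral_matrix e c"
  using assms by (intro matrix_eqI_orthonormal[OF e]) (simp add: spectral_matrix_mult_basis)

lemma spectral_matrix_one:
  fixes e :: "nat \<Rightarrow> real ^ 'm"
  assumes "orthonormal_basis CARD('m) e UNIV"
  shows "spectral_matrix e (\<lambda>i. 1) = mat 1"
  by (rule eq_spectral_matrix[OF assms, symmetric]) simp

lemma spectral_matrix_mult:
  fixes e :: "nat \<Rightarrow> real ^ 'm"
  assumes e: "orthonormal_basis CARD('m) e UNIV"
  shows "spectral_matrix e c ** spectral_matrix e c' = spectral_matrix e (\<lambda>i. c i * c' i)"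
  by (rule eq_spectral_matrix[OF e]) (simp add: matrix_vector_mul_assoc[symmetric] spectral_matrix_mult_basis[OF e]
      matrix_vector_mult_scaleR)

lemma is_pinv_unique:
  assumes "is_pinv A X" "is_pinv A Z"
  shows "X = Z"
proof -
  have *: "A ** X ** A = A" "X ** A ** X = X" "transpose (A ** X) = A ** X" "transpose (X ** A) = X ** A"
    "A ** Z ** A = A" "Z ** A ** Z = Z" "transpose (A ** Z) = A ** Z" "transpose (Z ** A) = Z ** A"
    using assms unfolding is_pinv_def by blast+
  have "A ** X = transpose ((A ** Z) ** (A ** X))"
    by (simp only: matrix_mul_assoc *)
  also have "\<dots> = (A ** X) ** (A ** Z)"
    by (simp only: matrix_transpose_mul[of "A ** Z"] *)
  also have "\<dots> = A ** Z" by (simp only: matrix_mul_assoc *)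
  finally have AX: "A ** X = A ** Z" .
  have "X ** A = transpose ((X ** A) ** (Z ** A))"
    using *(4,5) by (simp only: matrix_mul_assoc[symmetric])
  also have "\<dots> = (Z ** A) ** (X ** A)"
    by (simp only: matrix_transpose_mul[of "X ** A"] *)
  also have "\<dots> = Z ** (A ** X ** A)" by (simp only: matrix_mul_assoc)
  finally have XA: "X ** A = Z ** A" by (simp only: *)
  have "X = (X ** A) ** X" by (simp only: *)
  also have "\<dots> = Z ** (A ** X)" by (simp only: XA matrix_mul_assoc)
  also have "\<dots> = Z ** A ** Z" by (simp only: AX matrix_mul_assoc)
  finally show ?thesis by (simp only: *)
qed

text \<open>
  The convention \<open>inverse 0 = 0\<close> is what makes the pointwise inverse the pseudoinverse.
\<close>

lemma pinv_spectral_matrix: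
  fixes e :: "nat \<Rightarrow> real ^ 'm"
  assumes e: "orthonormal_basis CARD('m) e UNIV"
  shows "pinv (spectral_matrix e c) = spectral_matrix e (\<lambda>i. inverse (c i))"
proof -
  have 1: "c i * inverse (c i) * c i = c i" "inverse (c i) * c i * inverse (c i) = inverse (c i)" for i
    by (cases "c i = 0"; simp)+
  have "is_pinv (spectral_matrix e c) (spectral_matrix e (\<lambda>i. inverse (c i)))"
    by (simp add: is_pinv_def spectral_matrix_mult[OF e] transpose_spectral_matrix 1)
  then show ?thesis
    unfolding pinv_def by (blast intro: the_equality is_pinv_unique)
qed

lemma orthonormal_family_independent:
  fixes u :: "nat \<Rightarrow> 'a::euclidean_space"
  assumes "\<And>i j. i < k \<Longrightarrow> j < k \<Longrightarrow> u i \<bullet> u j = (if i = j then 1 else 0)" and "S \<subseteq> {..<k}"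
  shows "inj_on u S" "independent (u ` S)"
proof -
  show inj: "inj_on u S"
  proof (rule inj_onI)
    fix i j assume ij: "i \<in> S" "j \<in> S" "u i = u j"
    then have "i < k" "j < k" using assms(2) by auto
    then show "i = j" using assms(1)[of i j] assms(1)[of i i] ij(3) by (auto split: if_splits)
  qed
  show "independent (u ` S)"
  proof (rule pairwise_orthogonal_independent)
    show "pairwise orthogonal (u ` S)"
      using assms by (auto simp: pairwise_def orthogonal_def subset_iff)
    show "0 \<notin> u ` S"
      using assms(1)[of i i for i] assms(2) by (force simp: subset_iff)
  qed
qed

lemma orthonormal_family_full:
  fixes u :: "nat \<Rightarrow> real ^ 'm"
  assumes "\<And>i j. i < CARD('m) \<Longrightarrow> j < CARD('m) \<Longrightarrow> u i \<bullet> u j = (if i = j then 1 else 0)"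
  shows "orthonormal_basis CARD('m) u UNIV"
proof -
  have "inj_on u {..<CARD('m)}" "independent (u ` {..<CARD('m)})"
    by (rule orthonormal_family_independent[OF assms]; auto)+
  then have "dim (u ` {..<CARD('m)}) = DIM(real ^ 'm)"
    by (simp add: dim_eq_card_independent card_image)
  then have "span (u ` {..<CARD('m)}) = UNIV" by (simp only: dim_eq_full)
  then show ?thesis using assms by (simp add: orthonormal_basis_def)
qed

lemma spectral_decomposition_eq_spectral_matrix:
  assumes "spectral_decomposition M ev e"
  shows "M = spectral_matrix e ev"
  using assms eq_spectral_matrix[of e M ev] by (simp add: spectral_decomposition_def)

lemma spectral_decomposition_eigenvalue:
  fixes M :: "real ^ 'm ^ 'm"
  assumes "spectral_decomposition M ev e" "i < CARD('m)"
  shows "ev i = e i \<bullet> (M *v e i)"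
  using assms by (auto simp: spectral_decomposition_def orthonormal_basis_def)

text \<open>
  The eigenvalues converge along with the eigenvectors, being their Rayleigh quotients.
\<close>

lemma spectral_decomposition_limit:
  fixes M :: "nat \<Rightarrow> real ^ 'm ^ 'm"
  assumes dec: "\<And>k. spectral_decomposition (M k) (ev k) (e k)"
    and M: "M \<longlonglongrightarrow> M0" and e: "\<And>i. i < CARD('m) \<Longrightarrow> (\<lambda>k. e k i) \<longlonglongrightarrow> e0 i"
  defines "ev0 \<equiv> \<lambda>i. e0 i \<bullet> (M0 *v e0 i)"
  shows "\<And>i. i < CARD('m) \<Longrightarrow> (\<lambda>k. ev k i) \<longlonglongrightarrow> ev0 i" and "spectral_decomposition M0 ev0 e0"
proof -
  have Me: "(\<lambda>k. M k *v e k i) \<longlonglongrightarrow> M0 *v e0 i" if "i < CARD('m)" for i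
    by (intro matrix_vector_mult.tendsto M e that)
  show ev: "(\<lambda>k. ev k i) \<longlonglongrightarrow> ev0 i" if i: "i < CARD('m)" for i
  proof -
    have "(\<lambda>k. e k i \<bullet> (M k *v e k i)) \<longlonglongrightarrow> ev0 i"
      unfolding ev0_def by (intro tendsto_inner e Me i)
    then show ?thesis using spectral_decomposition_eigenvalue[OF dec i] by simp
  qed
  have "e0 i \<bullet> e0 j = (if i = j then 1 else 0)" if "i < CARD('m)" "j < CARD('m)" for i j
  proof -
    have "(\<lambda>k. e k i \<bullet> e k j) \<longlonglongrightarrow> e0 i \<bullet> e0 j" by (intro tendsto_inner e that)
    moreover have "e k i \<bullet> e k j = (if i = j then 1 else 0)" for k
      using dec[of k] that by (simp add: spectral_decomposition_def orthonormal_basis_def)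
    ultimately show ?thesis by (simp add: LIMSEQ_const_iff)
  qed
  then have "orthonormal_basis CARD('m) e0 UNIV" by (rule orthonormal_family_full)
  moreover have "M0 *v e0 i = ev0 i *\<^sub>R e0 i" if i: "i < CARD('m)" for i
  proof (rule LIMSEQ_unique[OF Me[OF i]])
    have "(\<lambda>k. ev k i *\<^sub>R e k i) \<longlonglongrightarrow> ev0 i *\<^sub>R e0 i" by (intro tendsto_scaleR ev e i)
    then show "(\<lambda>k. M k *v e k i) \<longlonglongrightarrow> ev0 i *\<^sub>R e0 i"
      using dec i by (simp add: spectral_decomposition_def)
  qed
  moreover have "ev0 i \<le> ev0 j" if "i \<le> j" "j < CARD('m)" for i j
    by (rule LIMSEQ_le[OF ev ev]) (use that dec in \<open>auto simp: spectral_decomposition_def\<close>)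
  ultimately show "spectral_decomposition M0 ev0 e0" by (simp add: spectral_decomposition_def)
qed

text \<open>
  The kernel is spanned by the eigenvectors with eigenvalue zero, which come first because no
  eigenvalue is negative. At the limit point this is the spectral gap after the \<open>b\<close>-th eigenvalue.
\<close>

lemma psd_eigenvalues_kernel:
  fixes M :: "real ^ 'm ^ 'm"
  assumes dec: "spectral_decomposition M ev e" and psd: "M \<in> psd_cone" and i: "i < CARD('m)"
  shows "i < dim (mat_ker M) \<Longrightarrow> ev i = 0" and "dim (mat_ker M) \<le> i \<Longrightarrow> 0 < ev i"
proof -
  define Z where "Z = {i. i < CARD('m) \<and> ev i = 0}"
  have on: "orthonormal_basis CARD('m) e UNIV" and eig: "\<And>i. i < CARD('m) \<Longrightarrow> M *v e i = ev i *\<^sub>R e i"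
    and sorted: "\<And>i j. i \<le> j \<Longrightarrow> j < CARD('m) \<Longrightarrow> ev i \<le> ev j"
    using dec by (auto simp: spectral_decomposition_def)
  have sym: "M \<in> sym_mats" using psd by (simp add: psd_cone_def)
  have nonneg: "0 \<le> ev i" if "i < CARD('m)" for i
    using spectral_decomposition_eigenvalue[OF dec that] psd by (simp add: psd_cone_def)
  have "mat_ker M = span (e ` Z)"
  proof
    show "span (e ` Z) \<subseteq> mat_ker M"
    proof (rule span_minimal)
      show "subspace (mat_ker M)"
        by (auto simp: mat_ker_def subspace_def algebra_simps)
    qed (auto simp: Z_def mat_ker_def eig)
    show "mat_ker M \<subseteq> span (e ` Z)"
    proof
      fix v assume "v \<in> mat_ker M"
      then have "ev j * (e j \<bullet> v) = 0" if "j < CARD('m)" for j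
        using symmetric_inner_swap[OF sym, of "e j" v] eig[OF that] by (simp add: mat_ker_def)
      then have z: "e j \<bullet> v = 0" if "j < CARD('m)" "j \<notin> Z" for j
        using that by (fastforce simp: Z_def)
      have "v = spectral_matrix e (\<lambda>i. 1) *v v" by (simp add: spectral_matrix_one[OF on])
      also have "\<dots> = (\<Sum>i<CARD('m). (e i \<bullet> v) *\<^sub>R e i)" by (simp add: spectral_matrix_mult_vec)
      also have "\<dots> = (\<Sum>i\<in>Z. (e i \<bullet> v) *\<^sub>R e i)"
        by (rule sum.mono_neutral_right) (use z in \<open>auto simp: Z_def\<close>)
      also have "\<dots> \<in> span (e ` Z)" by (intro span_sum span_scale span_base) auto
      finally show "v \<in> span (e ` Z)" .
    qed
  qed
  moreover have "inj_on e Z" "independent (e ` Z)"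
    by (rule orthonormal_family_independent[OF orthonormal_basis_inner[OF on]]; auto simp: Z_def)+
  ultimately have card: "dim (mat_ker M) = card Z"
    by (simp add: dim_eq_card_independent card_image)
  have fZ: "finite Z" by (simp add: Z_def)
  show "ev i = 0" if "i < dim (mat_ker M)"
  proof (rule ccontr)
    assume ne: "ev i \<noteq> 0"
    have "j < i" if "j \<in> Z" for j
    proof (rule ccontr)
      assume "\<not> j < i"
      then have "ev i \<le> 0" using sorted[of i j] that by (auto simp: Z_def)
      then show False using nonneg[OF i] ne by simp
    qed
    then have "Z \<subseteq> {..<i}" by auto
    then have "card Z \<le> i" using card_mono[of "{..<i}" Z] by simp
    then show False using that card by simp
  qed
  show "0 < ev i" if "dim (mat_ker M) \<le> i"
  proof (rule ccontr)
    assume "\<not> 0 < ev i"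
    then have "ev j = 0" if "j \<le> i" for j
      using sorted[OF that i] nonneg[of j] that i by simp
    then have "{..i} \<subseteq> Z" using i by (auto simp: Z_def)
    then have "Suc i \<le> card Z" using card_mono[OF fZ, of "{..i}"] by simp
    then show False using that card by simp
  qed
qed

text \<open>
  \<open>Y\<close> and \<open>N\<close> are the positive and negative part of \<open>G\<close>, and so are diagonal in any eigenbasis of
  \<open>G\<close>: applying \<open>N\<close> to \<open>G v = \<lambda> v\<close> gives \<open>- N (N v) = \<lambda> N v\<close>, hence
  \<open>- \<parallel>N v\<parallel>\<^sup>2 = \<lambda> \<langle>v, N v\<rangle>\<close>, which forces \<open>N v = 0\<close> if \<open>\<lambda> > 0\<close>, and likewise \<open>Y v = 0\<close> if
  \<open>\<lambda> \<le> 0\<close>.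
\<close>

lemma complementary_parts_spectral:
  fixes G Y N :: "real ^ 'm ^ 'm"
  assumes dec: "spectral_decomposition G ev e"
    and Y: "Y \<in> psd_cone" and N: "N \<in> psd_cone" and G: "G = Y - N" and YN: "Y ** N = 0"
  shows "Y = spectral_matrix e (\<lambda>i. max 0 (ev i))" and "N = spectral_matrix e (\<lambda>i. max 0 (- ev i))"
proof -
  have on: "orthonormal_basis CARD('m) e UNIV" and eig: "\<And>i. i < CARD('m) \<Longrightarrow> G *v e i = ev i *\<^sub>R e i"
    using dec by (auto simp: spectral_decomposition_def)
  have sY: "Y \<in> sym_mats" and sN: "N \<in> sym_mats" using Y N by (auto simp: psd_cone_def)
  have NY: "N ** Y = 0"
    using arg_cong[OF YN, of transpose] sY sN linear_0[OF linear_transpose]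
    by (simp add: matrix_transpose_mul sym_mats_def)
  have key: "N *v e i = 0 \<or> ev i \<le> 0" "Y *v e i = 0 \<or> ev i > 0" if i: "i < CARD('m)" for i
  proof -
    have split: "Y *v e i - N *v e i = ev i *\<^sub>R e i"
      using eig[OF i] by (simp add: G matrix_vector_mult_diff_rdistrib)
    have "N *v (Y *v e i - N *v e i) = - (N *v (N *v e i))"
      by (simp add: matrix_vector_mult_diff_distrib matrix_vector_mul_assoc NY)
    then have "- (N *v (N *v e i)) = ev i *\<^sub>R (N *v e i)"
      by (simp add: split matrix_vector_mult_scaleR)
    then have "e i \<bullet> (- (N *v (N *v e i))) = e i \<bullet> (ev i *\<^sub>R (N *v e i))" by (rule arg_cong)
    then have a: "(N *v e i) \<bullet> (N *v e i) = - (ev i * (e i \<bullet> (N *v e i)))"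
      by (simp add: symmetric_inner_swap[OF sN, of "e i" "N *v e i"])
    have "Y *v (Y *v e i - N *v e i) = Y *v (Y *v e i)"
      by (simp add: matrix_vector_mult_diff_distrib matrix_vector_mul_assoc YN)
    then have "Y *v (Y *v e i) = ev i *\<^sub>R (Y *v e i)"
      by (simp add: split matrix_vector_mult_scaleR)
    then have "e i \<bullet> (Y *v (Y *v e i)) = e i \<bullet> (ev i *\<^sub>R (Y *v e i))" by (rule arg_cong)
    then have b: "(Y *v e i) \<bullet> (Y *v e i) = ev i * (e i \<bullet> (Y *v e i))"
      by (simp add: symmetric_inner_swap[OF sY, of "e i" "Y *v e i"])
    have "0 \<le> e i \<bullet> (N *v e i)" "0 \<le> e i \<bullet> (Y *v e i)" using Y N by (auto simp: psd_cone_def)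
    then show "N *v e i = 0 \<or> ev i \<le> 0" "Y *v e i = 0 \<or> ev i > 0"
      using a b by (metis inner_eq_zero_iff inner_ge_zero less_eq_real_def mult_nonneg_nonneg
          neg_le_0_iff_le not_le order_antisym, metis inner_eq_zero_iff inner_ge_zero mult_nonpos_nonneg
          not_le order_antisym)
  qed
  have split: "Y *v e i - N *v e i = ev i *\<^sub>R e i" if "i < CARD('m)" for i
    using eig[OF that] by (simp add: G matrix_vector_mult_diff_rdistrib)
  show "Y = spectral_matrix e (\<lambda>i. max 0 (ev i))"
  proof (rule eq_spectral_matrix[OF on])
    fix i assume i: "i < CARD('m)"
    show "Y *v e i = max 0 (ev i) *\<^sub>R e i"
      using key[OF i] split[OF i] by (cases "ev i > 0") auto
  qed
  show "N = spectral_matrix e (\<lambda>i. max 0 (- ev i))"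
  proof (rule eq_spectral_matrix[OF on])
    fix i assume i: "i < CARD('m)"
    show "N *v e i = max 0 (- ev i) *\<^sub>R e i"
      using key[OF i] split[OF i]
      by (cases "ev i > 0") (auto simp: minus_equation_iff[of "N *v e i"])
  qed
qed

section \<open>Optimality conditions for penalized semidefinite problems\<close>

text \<open>
  Here \<open>B\<close> projects onto the span of the first \<open>b\<close> basis vectors and \<open>I - B\<close> onto that of the
  others, where \<open>X\<close> inverts \<open>spectral_matrix e y\<close>. With \<open>S = (I + B) / 2\<close> and \<open>E = X D S\<close> the sum
  \<open>(I - B) D S + S D (I - B)\<close> is \<open>D - B D B\<close>, and \<open>B D B\<close> vanishes by hypothesis. The
  factor \<open>S\<close> disappears from the second identity because the matrix with eigenvalues \<open>\<tau>\<close> lives on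
  the range of \<open>B\<close>, where \<open>S\<close> is the identity.
\<close>

lemma tangent_correction:
  fixes e :: "nat \<Rightarrow> real ^ 'm" and D :: "real ^ 'm ^ 'm"
  assumes on: "orthonormal_basis CARD('m) e UNIV" and D: "D \<in> sym_mats"
    and block: "\<And>i j. i < b \<Longrightarrow> j < b \<Longrightarrow> i < CARD('m) \<Longrightarrow> j < CARD('m) \<Longrightarrow> e i \<bullet> (D *v e j) = 0"
    and y: "\<And>i. b \<le> i \<Longrightarrow> i < CARD('m) \<Longrightarrow> y i \<noteq> 0"
    and \<tau>: "\<And>i. b \<le> i \<Longrightarrow> i < CARD('m) \<Longrightarrow> \<tau> i = 0"
  defines "X \<equiv> spectral_matrix e (\<lambda>i. if i < b then 0 else inverse (y i))"
  shows "\<exists>E. transpose E ** spectral_matrix e y + spectral_matrix e y ** E = D \<and>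
    spectral_matrix e \<tau> \<bullet> (transpose E ** spectral_matrix e y ** E) = spectral_matrix e \<tau> \<bullet> (D ** X ** D)"
proof -
  define B where "B = spectral_matrix e (\<lambda>i. if i < b then 1 else 0)"
  define S where "S = (1/2) *\<^sub>R (mat 1 + B)"
  define E where "E = X ** D ** S"
  have tD: "transpose D = D" using D by (simp add: sym_mats_def)
  have tX: "transpose X = X" and tB: "transpose B = B" by (simp_all add: X_def B_def transpose_spectral_matrix)
  have tS: "transpose S = S"
    using linear_add[OF linear_transpose, of "mat 1" B] by (simp add: S_def transpose_scalar tB)
  have congr: "spectral_matrix e c = spectral_matrix e c'" if "\<And>i. i < CARD('m) \<Longrightarrow> c i = c' i" for c c'
    using that by (simp add: spectral_matrix_def)
  have B1: "mat 1 - B = spectral_matrix e (\<lambda>i. if i < b then 0 else 1)"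
    by (rule eq_spectral_matrix[OF on]) (simp add: B_def matrix_vector_mult_diff_rdistrib spectral_matrix_mult_basis[OF on])
  have YX: "spectral_matrix e y ** X = mat 1 - B" and XY: "X ** spectral_matrix e y = mat 1 - B"
    unfolding B1 X_def spectral_matrix_mult[OF on] by (rule congr; use y in auto)+
  have XYX: "X ** spectral_matrix e y ** X = X"
    unfolding XY unfolding B1 unfolding X_def spectral_matrix_mult[OF on] by (rule congr) auto
  have BDB: "B ** D ** B = 0"
  proof (rule matrix_eqI_orthonormal[OF on])
    fix j assume j: "j < CARD('m)"
    have "B *v (D *v e j) = 0" if "j < b"
      unfolding B_def spectral_matrix_mult_vec using block[OF _ that _ j] by (intro sum.neutral) auto
    then show "(B ** D ** B) *v e j = 0 *v e j"
      by (simp add: matrix_vector_mul_assoc[symmetric] spectral_matrix_mult_basis[OF on j] B_def matrix_vector_mult_scaleR)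
  qed
  have tE: "transpose E = S ** D ** X"
    by (simp add: E_def matrix_transpose_mul tD tX tS matrix_mul_assoc)
  have YE: "spectral_matrix e y ** E = (mat 1 - B) ** D ** S" 
    by (simp add: E_def matrix_mul_assoc YX)
  have EY: "transpose E ** spectral_matrix e y = S ** D ** (mat 1 - B)"
    by (simp add: tE matrix_mul_assoc[symmetric] XY)
  have "transpose E ** spectral_matrix e y + spectral_matrix e y ** E = D"
  proof -
    have YE': "(mat 1 - B) ** D ** S = (1/2) *\<^sub>R (D + D ** B - B ** D - B ** D ** B)"
      and EY': "S ** D ** (mat 1 - B) = (1/2) *\<^sub>R (D - D ** B + B ** D - B ** D ** B)"
      by (simp_all add: S_def matrix_mult.add_left matrix_mult.add_right matrix_mult.diff_left
          matrix_mult.diff_right matrix_mult.scaleR_left matrix_mult.scaleR_right algebra_simps)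
    have "transpose E ** spectral_matrix e y + spectral_matrix e y ** E = D - B ** D ** B"
      unfolding YE EY YE' EY' by (simp add: vec_eq_iff field_simps)
    then show ?thesis by (simp add: BDB)
  qed
  moreover have "spectral_matrix e \<tau> \<bullet> (transpose E ** spectral_matrix e y ** E) = spectral_matrix e \<tau> \<bullet> (D ** X ** D)"
  proof -
    have "transpose E ** spectral_matrix e y ** E = S ** D ** (X ** spectral_matrix e y ** X) ** D ** S"
      unfolding tE unfolding E_def by (simp only: matrix_mul_assoc)
    also have "\<dots> = S ** (D ** X ** D) ** S"
      unfolding XYX by (simp only: matrix_mul_assoc)
    finally have T: "transpose E ** spectral_matrix e y ** E = S ** (D ** X ** D) ** S" .
    have "spectral_matrix e \<tau> \<bullet> (transpose E ** spectral_matrix e y ** E) = (S ** spectral_matrix e \<tau> ** S) \<bullet> (D ** X ** D)"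
      unfolding T
      by (subst inner_matrix_mult_right, subst inner_matrix_mult_left) (simp only: tS matrix_mul_assoc)
    also have "S ** spectral_matrix e \<tau> ** S = spectral_matrix e \<tau>"
    proof -
      have "B ** spectral_matrix e \<tau> = spectral_matrix e \<tau>" "spectral_matrix e \<tau> ** B = spectral_matrix e \<tau>"
        unfolding B_def spectral_matrix_mult[OF on] by (rule congr; use \<tau> in auto)+
      then have "S ** spectral_matrix e \<tau> = spectral_matrix e \<tau>" "spectral_matrix e \<tau> ** S = spectral_matrix e \<tau>"
        by (simp_all add: S_def matrix_mult.add_left matrix_mult.add_right matrix_mult.scaleR_left
            matrix_mult.scaleR_right scaleR_2[symmetric])
      then show ?thesis by simp
    qed
    finally show ?thesis .
  qed
  ultimately show ?thesis by blast
qed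

text \<open>
  Three families of curves are used: \<open>Y + t\<^sup>2 v v\<^sup>T\<close> shows that \<open>\<omega>\<close> is positive semidefinite
  through the second-order condition, the congruences of \<open>Y\<close> with \<open>d = 0\<close> give complementarity
  through the first-order condition, and with \<open>E\<close> adapted to \<open>d\<close> they give the last inequality.
\<close>

lemma penalized_psd_optimality:
  fixes g :: "'a::real_inner \<Rightarrow> real ^ 'm ^ 'm"
  assumes jf: "c2_jet f f1 f2" and jg: "c2_jet g g1 g2"
    and jh: "\<And>i. i < p \<Longrightarrow> c2_jet (h i) (h1 i) (h2 i)"
    and sym: "g x \<in> sym_mats" and Y: "Y \<in> psd_cone"
    and loc: "\<exists>\<epsilon>>0. \<forall>y\<in>ball x \<epsilon>. \<forall>Z\<in>psd_cone \<inter> ball Y \<epsilon>.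
        penalized f g p h x0 \<rho> x Y \<le> penalized f g p h x0 \<rho> y Z"
  defines "\<omega> \<equiv> \<rho> *\<^sub>R (Y - g x)" and "\<mu> \<equiv> \<lambda>i. \<rho> * h i x"
  shows "\<omega> \<in> psd_cone" and "Y ** \<omega> = 0"
    and "f1 x d + 4 * ((x - x0) \<bullet> (x - x0)) * ((x - x0) \<bullet> d) + (\<Sum>i<p. \<mu> i * h1 i x d)
           - \<omega> \<bullet> g1 x d = 0"
    and "\<lbrakk>transpose E ** Y + Y ** E = g1 x d; \<And>i. i < p \<Longrightarrow> h1 i x d = 0\<rbrakk> \<Longrightarrow>
         0 \<le> f2 x d d + 8 * ((x - x0) \<bullet> d)\<^sup>2 + 4 * ((x - x0) \<bullet> (x - x0)) * (d \<bullet> d)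
           + (\<Sum>i<p. \<mu> i * h2 i x d d) - \<omega> \<bullet> g2 x d d + 2 * (\<omega> \<bullet> (transpose E ** Y ** E))"
proof -
  have opt1: "f1 x d + 4 * ((x - x0) \<bullet> (x - x0)) * ((x - x0) \<bullet> d) + (\<Sum>i<p. \<mu> i * h1 i x d)
           - \<omega> \<bullet> (g1 x d - P) = 0"
    if "\<And>t. Y + t *\<^sub>R P + t\<^sup>2 *\<^sub>R Q \<in> psd_cone" for P Q d
    unfolding \<omega>_def \<mu>_def by (rule penalized_optimality_along_curve(1)[OF jf jg jh loc that])
  have opt2: "0 \<le> f2 x d d + 8 * ((x - x0) \<bullet> d)\<^sup>2 + 4 * ((x - x0) \<bullet> (x - x0)) * (d \<bullet> d)
           + (\<Sum>i<p. \<mu> i * h2 i x d d + \<rho> * (h1 i x d)\<^sup>2)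
           - \<omega> \<bullet> (g2 x d d - 2 *\<^sub>R Q) + \<rho> * (norm (g1 x d - P))\<^sup>2"
    if "\<And>t. Y + t *\<^sub>R P + t\<^sup>2 *\<^sub>R Q \<in> psd_cone" for P Q d
    unfolding \<omega>_def \<mu>_def by (rule penalized_optimality_along_curve(2)[OF jf jg jh loc that])
  have sY: "Y \<in> sym_mats" using Y by (simp add: psd_cone_def)
  have s\<omega>: "\<omega> \<in> sym_mats"
    unfolding \<omega>_def by (intro subspace_scale subspace_diff subspace_sym_mats sY sym)
  have curve: "Y + t *\<^sub>R (transpose E ** Y + Y ** E) + t\<^sup>2 *\<^sub>R (transpose E ** Y ** E) \<in> psd_cone" for t E
  proof -
    have "transpose (mat 1 + t *\<^sub>R E) ** Y ** (mat 1 + t *\<^sub>R E)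
        = Y + t *\<^sub>R (transpose E ** Y + Y ** E) + t\<^sup>2 *\<^sub>R (transpose E ** Y ** E)"
      by (simp add: linear_add[OF linear_transpose] transpose_scalar matrix_mult.add_left
          matrix_mult.add_right matrix_mult.scaleR_left matrix_mult.scaleR_right
          power2_eq_square algebra_simps)
    then show ?thesis using psd_congruence[OF Y, of "mat 1 + t *\<^sub>R E"] by simp
  qed
  \<comment> \<open>with \<open>P = 0\<close> the second-order condition sees \<open>v v\<^sup>T\<close> only through its pairing with \<open>\<omega>\<close>\<close>
  have ray: "Y + t *\<^sub>R 0 + t\<^sup>2 *\<^sub>R outer v v \<in> psd_cone" for t v
  proof -
    have "outer v v \<in> sym_mats" by (simp add: sym_mats_def transpose_outer)
    then have "Y + t *\<^sub>R 0 + t\<^sup>2 *\<^sub>R outer v v \<in> sym_mats"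
      using sY by (intro subspace_add subspace_scale subspace_0 subspace_sym_mats)
    moreover have "0 \<le> u \<bullet> ((Y + t *\<^sub>R 0 + t\<^sup>2 *\<^sub>R outer v v) *v u)" for u
    proof -
      have "u \<bullet> ((Y + t *\<^sub>R 0 + t\<^sup>2 *\<^sub>R outer v v) *v u) = u \<bullet> (Y *v u) + t\<^sup>2 * (v \<bullet> u)\<^sup>2"
        by (simp add: matrix_vector_mult_add_rdistrib inner_add_right scaleR_matrix_vector_assoc[symmetric]
            outer_mult_vec power2_eq_square inner_commute)
      then show ?thesis using Y by (simp add: psd_cone_def)
    qed
    ultimately show ?thesis by (simp add: psd_cone_def)
  qed
  have "0 \<le> v \<bullet> (\<omega> *v v)" for v
    using opt2[OF ray, of 0 v] 
    by (simp add: blinfun.zero_right inner_commute[of \<omega>] inner_outer)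
  then show "\<omega> \<in> psd_cone" using s\<omega> by (simp add: psd_cone_def)
  show "f1 x d + 4 * ((x - x0) \<bullet> (x - x0)) * ((x - x0) \<bullet> d) + (\<Sum>i<p. \<mu> i * h1 i x d)
           - \<omega> \<bullet> g1 x d = 0"
    using opt1[OF ray, of d] by simp
  show "Y ** \<omega> = 0"
  proof -
    define E where "E = Y ** \<omega>"
    have "\<omega> \<bullet> (transpose E ** Y + Y ** E) = 0"
      using opt1[OF curve[of _ E], of 0]
      by (simp add: blinfun.zero_right inner_diff_right inner_add_right)
    moreover have "\<omega> \<bullet> (transpose E ** Y) = E \<bullet> E"
    proof -
      have "\<omega> \<bullet> (transpose E ** Y) = (\<omega> ** Y) \<bullet> transpose E"
        using sY by (simp add: inner_matrix_mult_right sym_mats_def)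
      also have "\<dots> = transpose (Y ** \<omega>) \<bullet> transpose E"
        using sY s\<omega> by (simp add: matrix_transpose_mul sym_mats_def)
      finally show ?thesis by (simp add: inner_transpose E_def)
    qed
    moreover have "\<omega> \<bullet> (Y ** E) = E \<bullet> E"
      using sY by (simp add: inner_matrix_mult_left sym_mats_def E_def)
    ultimately have "E \<bullet> E = 0" by (simp add: inner_add_right)
    then show ?thesis by (simp add: E_def)
  qed
  show "0 \<le> f2 x d d + 8 * ((x - x0) \<bullet> d)\<^sup>2 + 4 * ((x - x0) \<bullet> (x - x0)) * (d \<bullet> d)
           + (\<Sum>i<p. \<mu> i * h2 i x d d) - \<omega> \<bullet> g2 x d d + 2 * (\<omega> \<bullet> (transpose E ** Y ** E))"
    if "transpose E ** Y + Y ** E = g1 x d" "\<And>i. i < p \<Longrightarrow> h1 i x d = 0"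
    using opt2[OF curve[of _ E], of d] that by (simp add: inner_diff_right)
qed

text \<open>
  Since \<open>Y\<close> and \<open>\<omega> / \<rho>\<close> are the positive and negative part of \<open>g x\<close>, an eigenbasis of \<open>g x\<close>
  diagonalizes \<open>\<omega>\<close>; this makes the pairing with the cone nonnegative and lets
  \<open>tangent_correction\<close> apply.
\<close>

lemma penalized_spectral_optimality:
  fixes g :: "real ^ 'n \<Rightarrow> real ^ 'm ^ 'm" and x :: "real ^ 'n"
  assumes jf: "c2_jet f f1 f2" and jg: "c2_jet g g1 g2"
    and jh: "\<And>i. i < p \<Longrightarrow> c2_jet (h i) (h1 i) (h2 i)"
    and sym: "\<And>y. g y \<in> sym_mats" and Y: "Y \<in> psd_cone" and \<rho>: "\<rho> > 0"
    and loc: "\<exists>\<epsilon>>0. \<forall>y\<in>ball x \<epsilon>. \<forall>Z\<in>psd_cone \<inter> ball Y \<epsilon>.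
        penalized f g p h x0 \<rho> x Y \<le> penalized f g p h x0 \<rho> y Z"
    and dec: "spectral_decomposition (g x) ev e"
  defines "\<omega> \<equiv> \<rho> *\<^sub>R (Y - g x)" and "\<mu> \<equiv> \<lambda>i. \<rho> * h i x"
  shows "Z \<in> psd_cone \<Longrightarrow> 0 \<le> \<omega> \<bullet> Z" and "\<omega> \<bullet> Y = 0"
    and "\<lbrakk>\<And>i. b \<le> i \<Longrightarrow> i < CARD('m) \<Longrightarrow> 0 < ev i;
          \<And>i. i < p \<Longrightarrow> h1 i x d = 0;
          \<And>i j. i < b \<Longrightarrow> j < b \<Longrightarrow> i < CARD('m) \<Longrightarrow> j < CARD('m) \<Longrightarrow> e i \<bullet> (g1 x d *v e j) = 0\<rbrakk> \<Longrightarrow>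
        0 \<le> f2 x d d + 8 * ((x - x0) \<bullet> d)\<^sup>2 + 4 * ((x - x0) \<bullet> (x - x0)) * (d \<bullet> d)
           + (\<Sum>i<p. \<mu> i * h2 i x d d) - \<omega> \<bullet> g2 x d d
           + 2 * (\<omega> \<bullet> (g1 x d ** spectral_matrix e (\<lambda>i. if i < b then 0 else inverse (ev i)) ** g1 x d))"
proof -
  have \<omega>psd: "\<omega> \<in> psd_cone" and Y\<omega>: "Y ** \<omega> = 0"
    using penalized_psd_optimality(1,2)[OF jf jg jh sym Y loc] by (auto simp: \<omega>_def)
  have on: "orthonormal_basis CARD('m) e UNIV" using dec by (simp add: spectral_decomposition_def)
  define N where "N = inverse \<rho> *\<^sub>R \<omega>"
  have N: "N = Y - g x" using \<rho> by (simp add: N_def \<omega>_def)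
  have "N \<in> psd_cone"
    using \<omega>psd \<rho> subspace_scale[OF subspace_sym_mats]
    by (auto simp: psd_cone_def N_def scaleR_matrix_vector_assoc[symmetric])
  moreover have "Y ** N = 0" by (simp add: N_def matrix_mult.scaleR_right Y\<omega>)
  moreover have "g x = Y - N" by (simp add: N)
  ultimately have Ys: "Y = spectral_matrix e (\<lambda>i. max 0 (ev i))" and Ns: "N = spectral_matrix e (\<lambda>i. max 0 (- ev i))"
    using complementary_parts_spectral[OF dec Y] by blast+
  have \<omega>s: "\<omega> = spectral_matrix e (\<lambda>i. \<rho> * max 0 (- ev i))"
  proof -
    have "\<omega> = \<rho> *\<^sub>R N" using \<rho> by (simp add: N_def)
    then show ?thesis by (simp add: Ns spectral_matrix_def scaleR_sum_right)
  qed
  show "0 \<le> \<omega> \<bullet> Z" if "Z \<in> psd_cone"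
    unfolding \<omega>s inner_spectral_matrix
    using that \<rho> by (intro sum_nonneg mult_nonneg_nonneg) (auto simp: psd_cone_def)
  show "\<omega> \<bullet> Y = 0"
  proof -
    have "\<omega> \<bullet> Y = \<omega> \<bullet> (Y ** mat 1)" by simp
    also have "\<dots> = (transpose Y ** \<omega>) \<bullet> mat 1" by (rule inner_matrix_mult_left)
    finally show ?thesis using Y Y\<omega> by (simp add: psd_cone_def sym_mats_def)
  qed
  show "0 \<le> f2 x d d + 8 * ((x - x0) \<bullet> d)\<^sup>2 + 4 * ((x - x0) \<bullet> (x - x0)) * (d \<bullet> d)
           + (\<Sum>i<p. \<mu> i * h2 i x d d) - \<omega> \<bullet> g2 x d d
           + 2 * (\<omega> \<bullet> (g1 x d ** spectral_matrix e (\<lambda>i. if i < b then 0 else inverse (ev i)) ** g1 x d))"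
    if pos: "\<And>i. b \<le> i \<Longrightarrow> i < CARD('m) \<Longrightarrow> 0 < ev i"
      and h0: "\<And>i. i < p \<Longrightarrow> h1 i x d = 0"
      and block: "\<And>i j. i < b \<Longrightarrow> j < b \<Longrightarrow> i < CARD('m) \<Longrightarrow> j < CARD('m) \<Longrightarrow> e i \<bullet> (g1 x d *v e j) = 0"
  proof -
    have "(g has_derivative g1 x) (at x)" using jg by (simp add: c2_jet_def)
    then have D: "g1 x d \<in> sym_mats" by (rule derivative_in_sym_mats[OF _ sym])
    have X: "spectral_matrix e (\<lambda>i. if i < b then 0 else inverse (max 0 (ev i)))
        = spectral_matrix e (\<lambda>i. if i < b then 0 else inverse (ev i))"
    proof -
      have "max 0 (ev i) = ev i" if "b \<le> i" "i < CARD('m)" for i using pos[OF that] by simp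
      then show ?thesis unfolding spectral_matrix_def by (intro sum.cong refl) (auto simp: not_less)
    qed
    have "\<exists>E. transpose E ** Y + Y ** E = g1 x d \<and> \<omega> \<bullet> (transpose E ** Y ** E)
          = \<omega> \<bullet> (g1 x d ** spectral_matrix e (\<lambda>i. if i < b then 0 else inverse (ev i)) ** g1 x d)"
      unfolding Ys \<omega>s X[symmetric]
    proof (rule tangent_correction[OF on D block])
      fix i assume "b \<le> i" "i < CARD('m)"
      with pos[of i] show "max 0 (ev i) \<noteq> 0" "\<rho> * max 0 (- ev i) = 0" by auto
    qed
    then obtain E where E: "transpose E ** Y + Y ** E = g1 x d"
        "\<omega> \<bullet> (transpose E ** Y ** E)
          = \<omega> \<bullet> (g1 x d ** spectral_matrix e (\<lambda>i. if i < b then 0 else inverse (ev i)) ** g1 x d)"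
      by blast
    show ?thesis
      unfolding E(2)[symmetric] unfolding \<omega>_def \<mu>_def
      by (rule penalized_psd_optimality(4)[OF jf jg jh sym Y loc E(1) h0])
  qed
qed

section \<open>Convergence of multipliers under Robinson's condition\<close>

lemma convergent_subsequence_finite_family:
  fixes F :: "nat \<Rightarrow> 'i \<Rightarrow> 'a::heine_borel"
  assumes "finite I" and "\<And>i. i \<in> I \<Longrightarrow> bounded (range (\<lambda>k. F k i))"
  shows "\<exists>r l. strict_mono (r :: nat \<Rightarrow> nat) \<and> (\<forall>i\<in>I. (\<lambda>k. F (r k) i) \<longlonglongrightarrow> l i)"
  using assms
proof (induction I)
  case empty
  then show ?case by (auto intro: exI[of _ id] simp: strict_mono_id)
next
  case (insert j I)
  then obtain r l where r: "strict_mono (r :: nat \<Rightarrow> nat)" "\<And>i. i \<in> I \<Longrightarrow> (\<lambda>k. F (r k) i) \<longlonglongrightarrow> l i"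
    by auto
  have "bounded (range (\<lambda>k. F (r k) j))"
    using insert.prems[of j] by (auto intro: bounded_subset)
  then obtain s m where s: "strict_mono (s :: nat \<Rightarrow> nat)" "((\<lambda>k. F (r k) j) \<circ> s) \<longlonglongrightarrow> m"
    using bounded_imp_convergent_subsequence by metis
  have "(\<lambda>k. F ((r \<circ> s) k) i) \<longlonglongrightarrow> (l(j := m)) i" if "i \<in> insert j I" for i
  proof (cases "i = j")
    case False
    then show ?thesis
      using LIMSEQ_subseq_LIMSEQ[OF r(2)[of i] s(1)] that by (auto simp: o_def)
  qed (use s in \<open>simp add: o_def\<close>)
  then show ?case
    using strict_mono_o[OF r(1) s(1)] by blast
qed

text \<open>
  Divide by \<open>T k = 1 + \<parallel>\<omega> k\<parallel> + \<Sum>\<bar>\<mu> k i\<bar>\<close> and pass to a limit of the normalized multipliers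
  and of \<open>1 / T k\<close>. If \<open>1 / T k\<close> tended to zero, the limit would be a nonzero solution of the
  stationarity equation without the objective, which Robinson's condition excludes: paired with the
  interior point it gives \<open>\<langle>\<omega>, Z\<rangle> = 0\<close> with \<open>Z\<close> interior to the cone, so \<open>\<omega> = 0\<close>, and
  then the rank condition gives \<open>\<mu> = 0\<close>. Hence \<open>1 / T k\<close> has a nonzero limit, and dividing by it
  recovers the original multipliers.
\<close>

lemma multipliers_convergent_subsequence:
  fixes g :: "'a::real_inner \<Rightarrow> real ^ 'm ^ 'm" and \<mu> :: "nat \<Rightarrow> nat \<Rightarrow> real"
  assumes jg: "c2_jet g g1 g2" and jh: "\<And>i. i < p \<Longrightarrow> c2_jet (h i) (h1 i) (h2 i)"
    and x: "x \<longlonglongrightarrow> x0" and Y: "Y \<longlonglongrightarrow> g x0"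
    and \<omega>sym: "\<And>k. \<omega> k \<in> sym_mats" and pos: "\<And>k Z. Z \<in> psd_cone \<Longrightarrow> 0 \<le> \<omega> k \<bullet> Z"
    and compl: "\<And>k. \<omega> k \<bullet> Y k = 0"
    and c: "\<And>d. (\<lambda>k. c k d) \<longlonglongrightarrow> c0 d"
    and stat: "\<And>k d. c k d + (\<Sum>i<p. \<mu> k i * h1 i (x k) d) - \<omega> k \<bullet> g1 (x k) d = 0"
    and rank: "\<And>\<nu>. (\<And>d. (\<Sum>i<p. \<nu> i * h1 i x0 d) = 0) \<Longrightarrow> \<forall>i<p. \<nu> i = 0"
    and slater: "g x0 + g1 x0 d0 \<in> top_of_set sym_mats interior_of psd_cone"
        "\<And>i. i < p \<Longrightarrow> h1 i x0 d0 = 0"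
  obtains r \<omega>0 \<mu>0 where "strict_mono (r :: nat \<Rightarrow> nat)" "(\<lambda>k. \<omega> (r k)) \<longlonglongrightarrow> \<omega>0"
    "\<And>i. i < p \<Longrightarrow> (\<lambda>k. \<mu> (r k) i) \<longlonglongrightarrow> \<mu>0 i"
proof -
  define T where "T = (\<lambda>k. 1 + norm (\<omega> k) + (\<Sum>i<p. \<bar>\<mu> k i\<bar>))"
  have T1: "1 \<le> T k" "norm (\<omega> k) \<le> T k" for k by (auto simp: T_def sum_nonneg)
  have T\<mu>: "\<bar>\<mu> k i\<bar> \<le> T k" if "i < p" for i k
  proof -
    have "\<bar>\<mu> k i\<bar> \<le> (\<Sum>i<p. \<bar>\<mu> k i\<bar>)" by (rule member_le_sum) (use that in auto)
    then show ?thesis using norm_ge_zero[of "\<omega> k"] unfolding T_def by linarith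
  qed
  have Tpos: "T k > 0" for k using T1(1)[of k] by linarith
  \<comment> \<open>the index \<open>p\<close>, one past the last multiplier, carries \<open>1 / T k\<close>\<close>
  define w where "w = (\<lambda>k. inverse (T k) *\<^sub>R \<omega> k)"
  define m where "m = (\<lambda>k i. inverse (T k) * (if i < p then \<mu> k i else 1))"
  have "bounded (range w)"
    by (rule boundedI[of _ 1]) (use T1(2) Tpos in \<open>auto simp: w_def field_simps abs_of_pos\<close>)
  then obtain s w0 where s: "strict_mono (s :: nat \<Rightarrow> nat)" and w0: "(\<lambda>k. w (s k)) \<longlonglongrightarrow> w0"
    using bounded_imp_convergent_subsequence[of w] by (auto simp: o_def)
  have "bounded (range (\<lambda>k. m (s k) i))" if "i \<in> {..p}" for i
    by (rule boundedI[of _ 1])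
       (use T1(1) T\<mu> Tpos in \<open>auto simp: m_def field_simps abs_mult abs_of_pos\<close>)
  then obtain t m0 where t: "strict_mono (t :: nat \<Rightarrow> nat)"
      and m0: "\<And>i. i \<le> p \<Longrightarrow> (\<lambda>k. m (s (t k)) i) \<longlonglongrightarrow> m0 i"
    using convergent_subsequence_finite_family[of "{..p}" "\<lambda>k. m (s k)"] by auto
  define r where "r = s \<circ> t"
  have r: "strict_mono r" unfolding r_def by (rule strict_mono_o[OF s t])
  have wr: "(\<lambda>k. w (r k)) \<longlonglongrightarrow> w0"
    using LIMSEQ_subseq_LIMSEQ[OF w0 t] by (simp add: r_def o_def)
  have mr: "(\<lambda>k. m (r k) i) \<longlonglongrightarrow> m0 i" if "i \<le> p" for i
    using m0[OF that] by (simp add: r_def)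
  have xr: "(\<lambda>k. x (r k)) \<longlonglongrightarrow> x0" and Yr: "(\<lambda>k. Y (r k)) \<longlonglongrightarrow> g x0"
    and cr: "(\<lambda>k. c (r k) d) \<longlonglongrightarrow> c0 d" for d
    using LIMSEQ_subseq_LIMSEQ[OF _ r] x Y c by (auto simp: o_def)
  have norm1: "m0 p + norm w0 + (\<Sum>i<p. \<bar>m0 i\<bar>) = 1"
  proof -
    have "m k p + norm (w k) + (\<Sum>i<p. \<bar>m k i\<bar>) = 1" for k
    proof -
      have "m k p = inverse (T k)" by (simp add: m_def)
      moreover have "norm (w k) = inverse (T k) * norm (\<omega> k)"
        using Tpos[of k] by (simp add: w_def)
      moreover have "(\<Sum>i<p. \<bar>m k i\<bar>) = inverse (T k) * (\<Sum>i<p. \<bar>\<mu> k i\<bar>)"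
        unfolding sum_distrib_left using Tpos[of k] by (intro sum.cong) (auto simp: m_def abs_mult)
      ultimately have "m k p + norm (w k) + (\<Sum>i<p. \<bar>m k i\<bar>)
          = inverse (T k) * (1 + norm (\<omega> k) + (\<Sum>i<p. \<bar>\<mu> k i\<bar>))"
        by (simp only: distrib_left mult_1_right)
      also have "\<dots> = inverse (T k) * T k" by (simp only: T_def)
      finally have "m k p + norm (w k) + (\<Sum>i<p. \<bar>m k i\<bar>) = inverse (T k) * T k" .
      then show ?thesis using Tpos[of k] by simp
    qed
    moreover have "(\<lambda>k. m (r k) p + norm (w (r k)) + (\<Sum>i<p. \<bar>m (r k) i\<bar>)) \<longlonglongrightarrow> m0 p + norm w0 + (\<Sum>i<p. \<bar>m0 i\<bar>)"
      by (intro tendsto_intros mr wr) auto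
    ultimately show ?thesis by (simp add: LIMSEQ_const_iff)
  qed
  have lim_stat: "m0 p * c0 d + (\<Sum>i<p. m0 i * h1 i x0 d) - w0 \<bullet> g1 x0 d = 0" for d
  proof -
    have "m k p * c k d + (\<Sum>i<p. m k i * h1 i (x k) d) - w k \<bullet> g1 (x k) d = 0" for k
    proof -
      have "m k p * c k d + (\<Sum>i<p. m k i * h1 i (x k) d) - w k \<bullet> g1 (x k) d
          = inverse (T k) * (c k d + (\<Sum>i<p. \<mu> k i * h1 i (x k) d) - \<omega> k \<bullet> g1 (x k) d)"
        by (simp add: m_def w_def sum_distrib_left algebra_simps)
      then show ?thesis using stat by simp
    qed
    moreover have "(\<lambda>k. m (r k) p * c (r k) d + (\<Sum>i<p. m (r k) i * h1 i (x (r k)) d) - w (r k) \<bullet> g1 (x (r k)) d)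
       \<longlonglongrightarrow> m0 p * c0 d + (\<Sum>i<p. m0 i * h1 i x0 d) - w0 \<bullet> g1 x0 d"
      by (intro tendsto_intros mr wr cr c2_jet_tendsto(2)[OF jg xr] c2_jet_tendsto(2)[OF jh xr]) auto
    ultimately show ?thesis by (simp add: LIMSEQ_const_iff)
  qed
  have w0sym: "w0 \<in> sym_mats"
  proof (rule closed_sequentially[OF closed_sym_mats _ wr])
    show "w (r k) \<in> sym_mats" for k
      unfolding w_def by (intro subspace_scale subspace_sym_mats \<omega>sym)
  qed
  have w0pos: "0 \<le> w0 \<bullet> Z" if "Z \<in> psd_cone" for Z
  proof (rule LIMSEQ_le_const[OF tendsto_inner[OF wr tendsto_const]])
    have "0 \<le> w (r k) \<bullet> Z" for k
      using pos[OF that, of "r k"] Tpos[of "r k"] by (simp add: w_def)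
    then show "\<exists>N. \<forall>n\<ge>N. 0 \<le> w (r n) \<bullet> Z" by blast
  qed
  have w0compl: "w0 \<bullet> g x0 = 0"
  proof -
    have "(\<lambda>k. w (r k) \<bullet> Y (r k)) \<longlonglongrightarrow> w0 \<bullet> g x0" by (intro tendsto_inner wr Yr)
    moreover have "w k \<bullet> Y k = 0" for k by (simp add: w_def compl)
    ultimately show ?thesis by (simp add: LIMSEQ_const_iff)
  qed
  have m0p: "m0 p \<noteq> 0"
  proof
    assume z: "m0 p = 0"
    define Z where "Z = g x0 + g1 x0 d0"
    have wZ: "w0 \<bullet> Z = 0"
      using lim_stat[of d0] slater(2) z w0compl by (simp add: Z_def inner_add_right)
    obtain W where W: "openin (top_of_set sym_mats) W" "Z \<in> W" "W \<subseteq> psd_cone"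
      using slater(1) unfolding interior_of_def Z_def by auto
    then obtain e where e: "e > 0" "\<And>y. y \<in> sym_mats \<Longrightarrow> dist y Z < e \<Longrightarrow> y \<in> W"
      unfolding openin_euclidean_subtopology_iff by metis
    define \<delta> where "\<delta> = e / (2 * (norm w0 + 1))"
    have n1: "norm w0 + 1 > 0" using norm_ge_zero[of w0] by linarith
    have \<delta>: "\<delta> > 0" using e(1) n1 by (simp add: \<delta>_def)
    \<comment> \<open>moving from the interior point \<open>Z\<close> against \<open>w0\<close> stays in the cone but decreases the pairing with \<open>w0\<close>\<close>
    have "dist (Z - \<delta> *\<^sub>R w0) Z = \<delta> * norm w0" using \<delta> by (simp add: dist_norm)
    also have "\<dots> \<le> \<delta> * (norm w0 + 1)" using \<delta> by (simp add: mult_left_mono)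
    also have "\<dots> = e / 2"
    proof -
      have "q / (2 * n) * n = q / 2" if "n \<noteq> 0" for q n :: real using that by simp
      then show ?thesis using n1 unfolding \<delta>_def by (metis less_irrefl)
    qed
    also have "\<dots> < e" using e(1) by simp
    finally have "Z - \<delta> *\<^sub>R w0 \<in> W"
      using e(2) W w0sym openin_imp_subset[OF W(1)]
      by (meson subsetD subspace_diff subspace_scale subspace_sym_mats)
    then have "0 \<le> w0 \<bullet> (Z - \<delta> *\<^sub>R w0)" using W(3) w0pos by blast
    then have "\<delta> * (w0 \<bullet> w0) \<le> 0" by (simp add: inner_diff_right wZ)
    then have w0z: "w0 = 0"
      using \<delta> by (metis inner_eq_zero_iff inner_ge_zero mult_pos_pos not_le order_le_less)
    then have "\<forall>i<p. m0 i = 0" using rank[of m0] lim_stat z by simp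
    then show False using norm1 z w0z by simp
  qed
  have inv: "(\<lambda>k. inverse (m (r k) p)) \<longlonglongrightarrow> inverse (m0 p)"
    by (intro tendsto_inverse mr m0p) simp
  show thesis
  proof (rule that[OF r])
    have "(\<lambda>k. inverse (m (r k) p) *\<^sub>R w (r k)) \<longlonglongrightarrow> inverse (m0 p) *\<^sub>R w0"
      by (intro tendsto_scaleR inv wr)
    moreover have "inverse (m k p) *\<^sub>R w k = \<omega> k" for k
      using Tpos[of k] by (simp add: m_def w_def)
    ultimately show "(\<lambda>k. \<omega> (r k)) \<longlonglongrightarrow> inverse (m0 p) *\<^sub>R w0" by simp
    fix i assume i: "i < p"
    have "(\<lambda>k. inverse (m (r k) p) * m (r k) i) \<longlonglongrightarrow> inverse (m0 p) * m0 i"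
      using i by (intro tendsto_mult inv mr) simp
    moreover have "inverse (m k p) * m k i = \<mu> k i" for k
      using Tpos[of k] i by (simp add: m_def)
    ultimately show "(\<lambda>k. \<mu> (r k) i) \<longlonglongrightarrow> inverse (m0 p) * m0 i" by simp
  qed
qed

lemma full_rank_coefficients:
  fixes a :: "nat \<Rightarrow> 'a::euclidean_space"
  assumes dim: "dim (a ` {..<p}) = p" and zero: "(\<Sum>i<p. \<nu> i *\<^sub>R a i) = 0" and i: "i < p"
  shows "\<nu> i = 0"
proof -
  have "p \<le> card (a ` {..<p})" using dim dim_le_card'[of "a ` {..<p}"] by simp
  then have card: "card (a ` {..<p}) = p" using card_image_le[of "{..<p}" a] by simp
  then have inj: "inj_on a {..<p}" by (intro eq_card_imp_inj_on) auto
  have "independent (a ` {..<p})"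
    using card_eq_dim[OF order_refl, of "a ` {..<p}"] card dim by (simp add: span_superset)
  moreover have "(\<Sum>v\<in>a ` {..<p}. \<nu> (the_inv_into {..<p} a v) *\<^sub>R v) = 0"
    using zero by (simp add: sum.reindex[OF inj] the_inv_into_f_f[OF inj])
  ultimately have "\<nu> (the_inv_into {..<p} a (a i)) = 0"
    using i independentD[of "a ` {..<p}" "a ` {..<p}" "\<lambda>v. \<nu> (the_inv_into {..<p} a v)" "a i"] by auto
  then show ?thesis using i by (simp add: the_inv_into_f_f[OF inj])
qed

section \<open>Families of vectors of constant rank\<close>

text \<open>
  \<open>v k\<close> is the orthogonal projection of \<open>d\<close>. Indices \<open>J\<close> of a basis among the limit vectors
  still index independent vectors for large \<open>k\<close>, with uniformly bounded coordinates
  (\<open>coeff_bound\<close>), and by constancy of the rank they span the whole family. Writing the component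
  \<open>y k\<close> of \<open>d\<close> in that span with bounded coordinates, \<open>\<parallel>y k\<parallel>\<^sup>2 = \<langle>y k, d\<rangle>\<close> is small because
  \<open>d\<close> is orthogonal to the limit vectors.
\<close>

lemma constant_rank_orthogonal_inner_limit:
  fixes a :: "nat \<Rightarrow> 'i \<Rightarrow> 'a::euclidean_space"
  assumes I: "finite I" and lim: "\<And>i. i \<in> I \<Longrightarrow> (\<lambda>k. a k i) \<longlonglongrightarrow> l i"
    and rank: "\<forall>\<^sub>F k in sequentially. dim (a k ` I) = dim (l ` I)"
    and d: "\<And>i. i \<in> I \<Longrightarrow> l i \<bullet> d = 0"
  obtains v where "v \<longlonglongrightarrow> d" "\<And>k i. i \<in> I \<Longrightarrow> a k i \<bullet> v k = 0"
proof -
  obtain B where B: "B \<subseteq> l ` I" "independent B" "card B = dim (l ` I)"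
    using basis_exists[of "l ` I"] by metis
  obtain J where J: "J \<subseteq> I" "inj_on l J" "B = l ` J"
    using B(1) unfolding subset_image_inj by blast
  have fJ: "finite J" using J(1) I finite_subset by blast
  have cJ: "card J = dim (l ` I)" using B(3) card_image[OF J(2)] J(3) by simp
  \<comment> \<open>coordinate functionals of the basis \<open>l ` J\<close>, extended to the whole space\<close>
  have "\<exists>\<phi>. linear \<phi> \<and> (\<forall>i\<in>J. \<phi> (l i) = (if i = j then 1 else 0 :: real))" for j
  proof -
    have "\<exists>\<phi>. linear \<phi> \<and> (\<forall>x\<in>l ` J. \<phi> x = (if the_inv_into J l x = j then 1 else 0 :: real))"
      by (rule linear_independent_extend) (use B(2) J(3) in simp)
    then show ?thesis using J(2) by (auto simp: the_inv_into_f_f)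
  qed
  then obtain \<phi> where \<phi>: "\<And>j. linear (\<phi> j)" "\<And>i j. i \<in> J \<Longrightarrow> \<phi> j (l i) = (if i = j then 1 else 0 :: real)"
    by metis
  have "\<exists>C>0. \<forall>x. \<bar>\<phi> j x\<bar> \<le> C * norm x" for j
    using linear_bounded_pos[OF \<phi>(1), of j] by (metis real_norm_def)
  then obtain K0 where K0: "\<And>j. K0 j > 0 \<and> (\<forall>x. \<bar>\<phi> j x\<bar> \<le> K0 j * norm x)"
    by metis
  define K where "K = 1 + (\<Sum>j\<in>J. K0 j)"
  have K: "K > 0" unfolding K_def using K0 by (smt (verit) sum_nonneg less_imp_le)
  define \<eta> where "\<eta> = (\<lambda>k. \<Sum>j\<in>J. norm (a k j - l j))"
  have \<eta>0: "\<eta> \<longlonglongrightarrow> 0"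
  proof -
    have "(\<lambda>k. \<Sum>j\<in>J. norm (a k j - l j)) \<longlonglongrightarrow> (\<Sum>j\<in>J. norm (l j - l j))"
      using lim J(1) by (intro tendsto_intros) auto
    then show ?thesis by (simp add: \<eta>_def)
  qed
  have ev: "\<forall>\<^sub>F k in sequentially. 2 * K * \<eta> k < 1"
  proof -
    have "(\<lambda>k. 2 * K * \<eta> k) \<longlonglongrightarrow> 2 * K * 0" by (intro tendsto_intros \<eta>0)
    then show ?thesis by (simp add: order_tendstoD(2))
  qed
  have coeff_bound: "(\<Sum>j\<in>J. \<bar>c j\<bar>) \<le> 2 * K * norm (\<Sum>j\<in>J. c j *\<^sub>R a k j)"
    if "2 * K * \<eta> k < 1" for c k
  proof -
    define C where "C = (\<Sum>j\<in>J. \<bar>c j\<bar>)"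
    have C0: "0 \<le> C" by (simp add: C_def sum_nonneg)
    have c: "\<bar>c j\<bar> \<le> K0 j * norm (\<Sum>i\<in>J. c i *\<^sub>R l i)" if "j \<in> J" for j
    proof -
      have "\<phi> j (\<Sum>i\<in>J. c i *\<^sub>R l i) = (\<Sum>i\<in>J. c i * \<phi> j (l i))"
        by (simp add: linear_sum[OF \<phi>(1)] linear_cmul[OF \<phi>(1)])
      also have "\<dots> = (\<Sum>i\<in>J. if i = j then c i else 0)"
        by (intro sum.cong) (auto simp: \<phi>(2))
      also have "\<dots> = c j" using that fJ by simp
      finally show ?thesis using K0 by metis
    qed
    have "C \<le> (\<Sum>j\<in>J. K0 j) * norm (\<Sum>i\<in>J. c i *\<^sub>R l i)"
      unfolding C_def sum_distrib_right by (intro sum_mono c)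
    also have "\<dots> \<le> K * norm (\<Sum>i\<in>J. c i *\<^sub>R l i)"
      by (intro mult_right_mono) (auto simp: K_def)
    also have "norm (\<Sum>i\<in>J. c i *\<^sub>R l i) \<le> norm (\<Sum>i\<in>J. c i *\<^sub>R a k i) + C * \<eta> k"
    proof -
      have "(\<Sum>i\<in>J. c i *\<^sub>R l i) = (\<Sum>i\<in>J. c i *\<^sub>R a k i) - (\<Sum>i\<in>J. c i *\<^sub>R (a k i - l i))"
        by (simp add: sum_subtractf algebra_simps)
      then have "norm (\<Sum>i\<in>J. c i *\<^sub>R l i)
          \<le> norm (\<Sum>i\<in>J. c i *\<^sub>R a k i) + norm (\<Sum>i\<in>J. c i *\<^sub>R (a k i - l i))"
        by (metis norm_triangle_ineq4)
      moreover have "norm (\<Sum>i\<in>J. c i *\<^sub>R (a k i - l i)) \<le> (\<Sum>i\<in>J. \<bar>c i\<bar> * norm (a k i - l i))"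
        by (rule sum_norm_le) simp
      moreover have "\<dots> \<le> (\<Sum>i\<in>J. \<bar>c i\<bar> * \<eta> k)"
        unfolding \<eta>_def by (intro sum_mono mult_left_mono member_le_sum fJ) auto
      ultimately show ?thesis
        unfolding C_def sum_distrib_right by linarith
    qed
    finally have "C \<le> K * norm (\<Sum>i\<in>J. c i *\<^sub>R a k i) + C * (K * \<eta> k)"
      using K by (simp add: algebra_simps)
    moreover have "C * (K * \<eta> k) \<le> C * (1 / 2)"
      using that C0 by (intro mult_left_mono) auto
    ultimately show ?thesis unfolding C_def by linarith
  qed
  have "\<exists>y z. y \<in> span (a k ` I) \<and> (\<forall>w \<in> span (a k ` I). orthogonal z w) \<and> d = y + z" for k
    using orthogonal_subspace_decomp_exists[of "a k ` I" d] by metis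
  then obtain y z where yz: "\<And>k. y k \<in> span (a k ` I)"
      "\<And>k w. w \<in> span (a k ` I) \<Longrightarrow> z k \<bullet> w = 0" "\<And>k. d = y k + z k"
    unfolding orthogonal_def by metis
  have y_small: "norm (y k) \<le> 2 * K * norm d * \<eta> k"
    if small: "2 * K * \<eta> k < 1" and rk: "dim (a k ` I) = dim (l ` I)" for k
  proof -
    have inj: "inj_on (a k) J"
    proof (rule inj_onI, rule ccontr)
      fix i j assume ij: "i \<in> J" "j \<in> J" "a k i = a k j" "i \<noteq> j"
      define c where "c = (\<lambda>s. if s = i then 1 else if s = j then - 1 else 0 :: real)"
      have "(\<Sum>s\<in>J. c s *\<^sub>R a k s) = (\<Sum>s\<in>{i, j}. c s *\<^sub>R a k s)"
        by (rule sum.mono_neutral_right) (use fJ ij in \<open>auto simp: c_def\<close>)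
      also have "\<dots> = 0" using ij by (simp add: c_def)
      finally have "(\<Sum>s\<in>J. \<bar>c s\<bar>) \<le> 0" using coeff_bound[OF small, of c] by simp
      moreover have "\<bar>c i\<bar> \<le> (\<Sum>s\<in>J. \<bar>c s\<bar>)" by (rule member_le_sum) (use fJ ij in auto)
      ultimately show False by (simp add: c_def)
    qed
    have ind: "independent (a k ` J)"
    proof (rule independent_if_scalars_zero)
      fix f x assume s: "(\<Sum>x\<in>a k ` J. f x *\<^sub>R x) = 0" and x: "x \<in> a k ` J"
      then obtain j where j: "j \<in> J" "x = a k j" by auto
      have "(\<Sum>s\<in>J. f (a k s) *\<^sub>R a k s) = 0" using s by (simp add: sum.reindex[OF inj])
      then have "(\<Sum>s\<in>J. \<bar>f (a k s)\<bar>) \<le> 0" using coeff_bound[OF small, of "\<lambda>s. f (a k s)"] by simp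
      moreover have "\<bar>f (a k j)\<bar> \<le> (\<Sum>s\<in>J. \<bar>f (a k s)\<bar>)" by (rule member_le_sum) (use fJ j in auto)
      ultimately show "f x = 0" using j by simp
    qed (use fJ in simp)
    have card: "card (a k ` J) = dim (a k ` I)" using inj cJ rk by (simp add: card_image)
    then have "a k ` I \<subseteq> span (a k ` J)"
      using card_eq_dim[OF _ card] J(1) ind fJ by (metis finite_imageI image_mono)
    then have "span (a k ` I) \<subseteq> span (a k ` J)" by (simp add: span_minimal)
    then have "y k \<in> span (a k ` J)" using yz(1) by blast
    then obtain u where u: "y k = (\<Sum>v\<in>a k ` J. u v *\<^sub>R v)"
      using fJ by (auto simp: span_finite)
    define c where "c = (\<lambda>j. u (a k j))"
    have c: "y k = (\<Sum>j\<in>J. c j *\<^sub>R a k j)"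
      by (simp add: u c_def sum.reindex[OF inj])
    have "norm (y k) * norm (y k) = y k \<bullet> d"
    proof -
      have "z k \<bullet> y k = 0" using yz(2)[OF yz(1)] .
      then have "y k \<bullet> d = y k \<bullet> y k"
        by (subst yz(3)[of k]) (simp add: inner_add_right inner_commute)
      then show ?thesis by (simp add: power2_eq_square flip: power2_norm_eq_inner)
    qed
    also have "\<dots> = (\<Sum>j\<in>J. c j * ((a k j - l j) \<bullet> d))"
      unfolding c inner_sum_left using d J(1) by (intro sum.cong) (auto simp: inner_diff_left)
    also have "\<dots> \<le> (\<Sum>j\<in>J. \<bar>c j\<bar> * (\<eta> k * norm d))"
    proof (rule sum_mono)
      fix j assume j: "j \<in> J"
      have "\<bar>(a k j - l j) \<bullet> d\<bar> \<le> norm (a k j - l j) * norm d" by (rule Cauchy_Schwarz_ineq2)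
      also have "\<dots> \<le> \<eta> k * norm d"
        unfolding \<eta>_def using j fJ by (intro mult_right_mono member_le_sum) auto
      finally have "\<bar>c j * ((a k j - l j) \<bullet> d)\<bar> \<le> \<bar>c j\<bar> * (\<eta> k * norm d)"
        by (simp add: abs_mult mult_left_mono)
      then show "c j * ((a k j - l j) \<bullet> d) \<le> \<bar>c j\<bar> * (\<eta> k * norm d)" by linarith
    qed
    also have "\<dots> = (\<Sum>j\<in>J. \<bar>c j\<bar>) * (\<eta> k * norm d)" by (simp add: sum_distrib_right)
    also have "\<dots> \<le> (2 * K * norm (y k)) * (\<eta> k * norm d)"
      using coeff_bound[OF small, of c] c
      by (intro mult_right_mono) (auto simp: \<eta>_def sum_nonneg)
    finally have "norm (y k) * norm (y k) \<le> norm (y k) * (2 * K * norm d * \<eta> k)"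
      by (simp add: algebra_simps)
    moreover have "0 \<le> 2 * K * norm d * \<eta> k" using K by (simp add: \<eta>_def sum_nonneg)
    ultimately show ?thesis
      by (cases "norm (y k) = 0") (auto simp: mult_le_cancel_left)
  qed
  have "y \<longlonglongrightarrow> 0"
  proof (rule Lim_null_comparison)
    show "\<forall>\<^sub>F k in sequentially. norm (y k) \<le> 2 * K * norm d * \<eta> k"
      using ev rank by eventually_elim (rule y_small)
    have "(\<lambda>k. 2 * K * norm d * \<eta> k) \<longlonglongrightarrow> 2 * K * norm d * 0" by (intro tendsto_intros \<eta>0)
    then show "(\<lambda>k. 2 * K * norm d * \<eta> k) \<longlonglongrightarrow> 0" by simp
  qed
  then have "(\<lambda>k. d - y k) \<longlonglongrightarrow> d - 0" by (intro tendsto_intros)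
  moreover have "d - y k = z k" for k using yz(3)[of k] by (simp add: algebra_simps)
  ultimately have "z \<longlonglongrightarrow> d" by simp
  moreover have "a k i \<bullet> z k = 0" if "i \<in> I" for k i
    using yz(2)[of "a k i" k] that by (simp add: inner_commute span_base)
  ultimately show thesis using that by blast
qed

text \<open>
  The power series converges absolutely at some \<open>x + s w\<close> all of whose coordinates relative to \<open>x\<close>
  are nonzero, and at \<open>y\<close> near \<open>x\<close> every nonconstant term is at most a multiple of \<open>\<parallel>y - x\<parallel>\<close> times
  the term there. If \<open>V\<close> lay in a coordinate hyperplane, no such point could be chosen in \<open>S\<close>, which
  is open only relative to \<open>V\<close>; the vector \<open>w\<close> excludes this.
\<close>

lemma real_analytic_on_tendsto:
  fixes F :: "'a::euclidean_space \<Rightarrow> 'b::euclidean_space"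
  assumes an: "real_analytic_on F S" and x: "x \<in> S"
    and op: "openin (top_of_set V) S" and V: "subspace V"
    and w: "w \<in> V" "\<And>b. b \<in> Basis \<Longrightarrow> w \<bullet> b \<noteq> 0"
  shows "(F \<longlongrightarrow> F x) (at x within S)"
proof -
  obtain r c where r: "r > 0" and sum: "\<And>y. y \<in> S \<inter> ball x r \<Longrightarrow>
      ((\<lambda>\<alpha>. (\<Prod>b\<in>Basis. ((y - x) \<bullet> b) ^ \<alpha> b) *\<^sub>R c \<alpha>) has_sum F y) (Basis \<rightarrow>\<^sub>E UNIV)"
    using bspec[OF an[unfolded real_analytic_on_def] x] by (elim exE conjE) blast
  define I where "I = (Basis \<rightarrow>\<^sub>E UNIV :: ('a \<Rightarrow> nat) set)"
  define mon where "mon = (\<lambda>\<alpha> (v :: 'a). \<Prod>b\<in>Basis. (v \<bullet> b) ^ \<alpha> b :: real)"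
  have sum': "((\<lambda>\<alpha>. mon \<alpha> (y - x) *\<^sub>R c \<alpha>) has_sum F y) I" if "y \<in> S" "dist y x < r" for y
    using sum[of y] that by (simp add: I_def mon_def dist_commute)
  obtain e where e: "e > 0" "\<And>y. y \<in> V \<Longrightarrow> dist y x < e \<Longrightarrow> y \<in> S"
    using op x unfolding openin_euclidean_subtopology_iff by metis
  have xV: "x \<in> V" using op x openin_imp_subset by blast
  (* adding one to the norm only avoids a division by zero *)
  define s where "s = min e r / (2 * (norm w + 1))"
  have s: "s > 0" using e r by (simp add: s_def add_nonneg_pos)
  have "norm (s *\<^sub>R w) < min e r"
  proof -
    have "norm (s *\<^sub>R w) \<le> s * (norm w + 1)" using s by (simp add: mult_left_mono)
    also have "\<dots> = min e r / 2"
    proof -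
      have "q / (2 * n) * n = q / 2" if "n \<noteq> 0" for q n :: real using that by simp
      moreover have "norm w + 1 \<noteq> 0" using norm_ge_zero[of w] by linarith
      ultimately show ?thesis unfolding s_def by blast
    qed
    also have "\<dots> < min e r" using e r by (auto simp: min_def)
    finally show ?thesis .
  qed
  then have zS: "x + s *\<^sub>R w \<in> S" "dist (x + s *\<^sub>R w) x < r"
    using e(2)[of "x + s *\<^sub>R w"] xV w(1) V
    by (auto simp: dist_norm subspace_add subspace_scale)
  have mon0: "mon \<alpha> 0 = 0" if "\<alpha> \<in> I" "b \<in> Basis" "\<alpha> b \<noteq> 0" for \<alpha> b
    unfolding mon_def by (rule prod_zero) (use that in auto)
  define m where "m = Min ((\<lambda>b. \<bar>s *\<^sub>R w \<bullet> b\<bar>) ` Basis)"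
  have m: "m > 0" "\<And>b. b \<in> Basis \<Longrightarrow> m \<le> \<bar>s *\<^sub>R w \<bullet> b\<bar>"
    using w(2) s by (auto simp: m_def)
  have mon_bound: "\<bar>mon \<alpha> v - mon \<alpha> 0\<bar> \<le> norm v / m * \<bar>mon \<alpha> (s *\<^sub>R w)\<bar>"
    if \<alpha>: "\<alpha> \<in> I" and v: "norm v < m" for \<alpha> v
  proof (cases "\<forall>b\<in>Basis. \<alpha> b = 0")
    case True
    then show ?thesis using m by (simp add: mon_def)
  next
    case False
    then obtain b0 where b0: "b0 \<in> Basis" "\<alpha> b0 \<noteq> 0" by auto
    define \<theta> where "\<theta> = norm v / m"
    have \<theta>: "0 \<le> \<theta>" "\<theta> \<le> 1" using v m by (auto simp: \<theta>_def)
    have abs_mon: "\<bar>mon \<alpha> u\<bar> = (\<Prod>b\<in>Basis. \<bar>u \<bullet> b\<bar> ^ \<alpha> b)" for u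
      by (simp add: mon_def abs_prod power_abs)
    have "\<bar>mon \<alpha> v\<bar> = (\<Prod>b\<in>Basis. \<bar>v \<bullet> b\<bar> ^ \<alpha> b)" by (rule abs_mon)
    also have "\<dots> \<le> (\<Prod>b\<in>Basis. (\<theta> * \<bar>s *\<^sub>R w \<bullet> b\<bar>) ^ \<alpha> b)"
    proof (intro prod_mono conjI power_mono)
      fix b :: 'a assume b: "b \<in> Basis"
      have "\<bar>v \<bullet> b\<bar> \<le> norm v" by (rule Basis_le_norm[OF b])
      also have "\<dots> = \<theta> * m" using m by (simp add: \<theta>_def)
      also have "\<dots> \<le> \<theta> * \<bar>s *\<^sub>R w \<bullet> b\<bar>" using m(2)[OF b] \<theta> by (intro mult_left_mono) auto
      finally show "\<bar>v \<bullet> b\<bar> \<le> \<theta> * \<bar>s *\<^sub>R w \<bullet> b\<bar>" .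
    qed auto
    also have "\<dots> = \<theta> ^ (\<Sum>b\<in>Basis. \<alpha> b) * \<bar>mon \<alpha> (s *\<^sub>R w)\<bar>"
      unfolding abs_mon power_mult_distrib prod.distrib power_sum ..
    also have "\<dots> \<le> \<theta> * \<bar>mon \<alpha> (s *\<^sub>R w)\<bar>"
    proof (rule mult_right_mono)
      have "\<alpha> b0 \<le> (\<Sum>b\<in>Basis. \<alpha> b)" by (rule member_le_sum) (use b0 in auto)
      then have "1 \<le> (\<Sum>b\<in>Basis. \<alpha> b)" using b0 by linarith
      then show "\<theta> ^ (\<Sum>b\<in>Basis. \<alpha> b) \<le> \<theta>"
        using power_decreasing[of 1 _ \<theta>] \<theta> by simp
    qed simp
    finally show ?thesis using mon0[OF \<alpha> b0] by (simp add: \<theta>_def)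
  qed
  have "((\<lambda>y. F y \<bullet> j) \<longlongrightarrow> F x \<bullet> j) (at x within S)" if j: "j \<in> Basis" for j
  proof -
    have sumj: "((\<lambda>\<alpha>. mon \<alpha> (y - x) * (c \<alpha> \<bullet> j)) has_sum F y \<bullet> j) I"
      if "y \<in> S" "dist y x < r" for y
      using has_sum_bounded_linear[OF bounded_linear_inner_left sum'[OF that], of j]
      by (simp add: o_def)
    have "(\<lambda>\<alpha>. mon \<alpha> (s *\<^sub>R w) * (c \<alpha> \<bullet> j)) summable_on I"
      using sumj[OF zS] by (auto simp: summable_on_def)
    then have "(\<lambda>\<alpha>. \<bar>mon \<alpha> (s *\<^sub>R w) * (c \<alpha> \<bullet> j)\<bar>) summable_on I"
      unfolding summable_on_iff_abs_summable_on_real[of "\<lambda>\<alpha>. mon \<alpha> (s *\<^sub>R w) * (c \<alpha> \<bullet> j)"] real_norm_def .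
    then obtain K where K: "((\<lambda>\<alpha>. \<bar>mon \<alpha> (s *\<^sub>R w) * (c \<alpha> \<bullet> j)\<bar>) has_sum K) I"
      by (auto simp: summable_on_def)
    have bound: "\<bar>F y \<bullet> j - F x \<bullet> j\<bar> \<le> norm (y - x) / m * K"
      if y: "y \<in> S" "dist y x < min m r" for y
    proof -
      have D: "((\<lambda>\<alpha>. mon \<alpha> (y - x) * (c \<alpha> \<bullet> j) - mon \<alpha> 0 * (c \<alpha> \<bullet> j)) has_sum F y \<bullet> j - F x \<bullet> j) I"
        using has_sum_add[OF sumj[of y] has_sum_uminusI[OF sumj[of x]]] y x r by simp
      have U: "((\<lambda>\<alpha>. norm (y - x) / m * \<bar>mon \<alpha> (s *\<^sub>R w) * (c \<alpha> \<bullet> j)\<bar>) has_sum norm (y - x) / m * K) I"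
        by (rule has_sum_cmult_right[OF K])
      have t: "\<bar>mon \<alpha> (y - x) * (c \<alpha> \<bullet> j) - mon \<alpha> 0 * (c \<alpha> \<bullet> j)\<bar>
          \<le> norm (y - x) / m * \<bar>mon \<alpha> (s *\<^sub>R w) * (c \<alpha> \<bullet> j)\<bar>" if "\<alpha> \<in> I" for \<alpha>
      proof -
        have "\<bar>mon \<alpha> (y - x) - mon \<alpha> 0\<bar> * \<bar>c \<alpha> \<bullet> j\<bar>
            \<le> norm (y - x) / m * \<bar>mon \<alpha> (s *\<^sub>R w)\<bar> * \<bar>c \<alpha> \<bullet> j\<bar>"
          using mon_bound[OF that, of "y - x"] y by (intro mult_right_mono) (auto simp: dist_norm)
        then show ?thesis by (simp add: abs_mult mult.assoc flip: left_diff_distrib)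
      qed
      have "F y \<bullet> j - F x \<bullet> j \<le> norm (y - x) / m * K"
        by (rule has_sum_mono[OF D U]) (rule abs_le_D1[OF t])
      moreover have "- (F y \<bullet> j - F x \<bullet> j) \<le> norm (y - x) / m * K"
        by (rule has_sum_mono[OF has_sum_uminusI[OF D] U]) (rule abs_le_D2[OF t])
      ultimately show ?thesis by linarith
    qed
    have "((\<lambda>y. F y \<bullet> j - F x \<bullet> j) \<longlongrightarrow> 0) (at x within S)"
    proof (rule Lim_null_comparison)
      show "\<forall>\<^sub>F y in at x within S. norm (F y \<bullet> j - F x \<bullet> j) \<le> norm (y - x) / m * K"
        unfolding eventually_at
        by (rule exI[of _ "min m r"]) (use m r bound in auto)
      have "((\<lambda>y. norm (y - x) / m * K) \<longlongrightarrow> norm (x - x) / m * K) (at x within S)"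
        using m by (intro tendsto_intros) auto
      then show "((\<lambda>y. norm (y - x) / m * K) \<longlongrightarrow> 0) (at x within S)" by simp
    qed
    then show ?thesis by (rule LIM_zero_cancel)
  qed
  then show ?thesis by (subst tendsto_componentwise_iff) auto
qed

text \<open>
  The matrix with all entries equal to one is symmetric and has no vanishing coordinate.
\<close>

lemma analytic_eigenbasis_tendsto:
  fixes A :: "real ^ 'm ^ 'm"
  assumes ae: "analytic_eigenbasis A b U N0 UU" and i: "i < b"
    and M: "M \<longlonglongrightarrow> A" "\<And>k. M k \<in> N0"
  shows "(\<lambda>k. UU (M k) i) \<longlonglongrightarrow> U i"
proof -
  define w :: "real ^ 'm ^ 'm" where "w = (\<chi> i j. 1)"
  have "w \<in> sym_mats" by (simp add: w_def sym_mats_def transpose_def)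
  moreover have "w \<bullet> c \<noteq> 0" if "c \<in> Basis" for c
    using that by (auto simp: Basis_vec_def w_def inner_axis)
  moreover have "real_analytic_on (\<lambda>M. UU M i) N0" "A \<in> N0" "openin (top_of_set sym_mats) N0"
    and U: "UU A i = U i"
    using ae i by (auto simp: analytic_eigenbasis_def)
  ultimately have "((\<lambda>M. UU M i) \<longlongrightarrow> UU A i) (at A within N0)"
    using real_analytic_on_tendsto[OF _ _ _ subspace_sym_mats] by blast
  then have "continuous (at A within N0) (\<lambda>M. UU M i)" by (simp add: continuous_within)
  from continuous_within_tendsto_compose'[OF this M(2) M(1)] U show ?thesis by simp
qed

section \<open>Derivatives in coordinates and the Lagrangian\<close>

lemma partial_deriv_eq:
  assumes "(F has_derivative F') (at x)"
  shows "partial_deriv l F x = F' (axis l 1)"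
proof -
  have "((\<lambda>t. x + t *\<^sub>R axis l 1) has_derivative (\<lambda>s. s *\<^sub>R axis l 1)) (at 0)"
    by (auto intro!: derivative_eq_intros)
  from has_derivative_compose[OF this, of F F'] assms
  have "((\<lambda>t. F (x + t *\<^sub>R axis l 1)) has_derivative (\<lambda>s. F' (s *\<^sub>R axis l 1))) (at 0)"
    by simp
  then have "((\<lambda>t. F (x + t *\<^sub>R axis l 1)) has_vector_derivative F' (axis l 1)) (at 0)"
    using linear_cmul[OF has_derivative_linear[OF assms]] by (simp add: has_vector_derivative_def)
  then show ?thesis unfolding partial_deriv_def by (rule vector_derivative_at)
qed

lemma linear_axis_expansion:
  fixes d :: "real ^ 'n" and F' :: "real ^ 'n \<Rightarrow> 'b::real_vector"
  assumes "linear F'"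
  shows "(\<Sum>l\<in>UNIV. (d $ l) *\<^sub>R F' (axis l 1)) = F' d"
proof -
  have "F' d = F' (\<Sum>l\<in>UNIV. (d $ l) *\<^sub>R axis l 1)" by (simp add: basis_expansion flip: scalar_mult_eq_scaleR)
  then show ?thesis by (simp add: linear_sum[OF assms] linear_cmul[OF assms])
qed

lemma dir_deriv_eq:
  assumes "(F has_derivative F') (at x)"
  shows "dir_deriv F x d = F' d"
  by (simp add: dir_deriv_def partial_deriv_eq[OF assms] linear_axis_expansion has_derivative_linear[OF assms])

lemma grad_inner_eq:
  assumes "(F has_derivative F') (at x)"
  shows "grad F x \<bullet> d = F' d"
  using dir_deriv_eq[OF assms, of d] by (simp add: dir_deriv_def grad_def inner_vec_def mult.commute)

lemma hess_quadratic_form: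
  fixes F :: "real ^ 'n \<Rightarrow> real"
  assumes d1: "\<And>x. (F has_derivative F1 x) (at x)"
    and d2: "\<And>v. ((\<lambda>x. F1 x v) has_derivative (\<lambda>u. F2 u v)) (at x)"
  shows "d \<bullet> (hess F x *v d) = F2 d d"
proof -
  have "partial_deriv j F = (\<lambda>x. F1 x (axis j 1))" for j
    using partial_deriv_eq[OF d1] by auto
  then have h: "hess F x $ i $ j = F2 (axis i 1) (axis j 1)" for i j
    by (simp add: hess_def partial_deriv_eq[OF d2])
  have lin: "linear (\<lambda>u. F2 u v)" for v by (rule has_derivative_linear[OF d2])
  have F2d: "F2 u d = (\<Sum>j\<in>UNIV. (d $ j) * F2 u (axis j 1))" for u
  proof -
    have "((\<lambda>x. \<Sum>j\<in>UNIV. (d $ j) * F1 x (axis j 1)) has_derivative (\<lambda>u. \<Sum>j\<in>UNIV. (d $ j) * F2 u (axis j 1))) (at x)"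
      by (intro derivative_intros d2)
    moreover have "(\<Sum>j\<in>UNIV. (d $ j) * F1 x (axis j 1)) = F1 x d" for x
      using linear_axis_expansion[OF has_derivative_linear[OF d1], of d x] by simp
    ultimately show ?thesis using has_derivative_unique[OF d2[of d]] by (simp add: fun_eq_iff)
  qed
  have "d \<bullet> (hess F x *v d) = (\<Sum>i\<in>UNIV. d $ i * (\<Sum>j\<in>UNIV. F2 (axis i 1) (axis j 1) * d $ j))"
    by (simp add: inner_vec_def matrix_vector_mult_def h)
  also have "\<dots> = (\<Sum>i\<in>UNIV. (d $ i) *\<^sub>R F2 (axis i 1) d)"
    by (simp add: F2d[of "axis _ 1"] mult.commute)
  also have "\<dots> = F2 d d" by (rule linear_axis_expansion[OF lin])
  finally show ?thesis .
qed

lemma sigma_term_quadratic_form: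
  fixes g :: "real ^ 'n \<Rightarrow> real ^ 'm ^ 'm"
  assumes "\<omega> \<in> sym_mats"
  shows "d \<bullet> (sigma_term g x \<omega> *v d) = 2 * (\<omega> \<bullet> (dir_deriv g x d ** pinv (g x) ** dir_deriv g x d))"
proof -
  have "d \<bullet> (sigma_term g x \<omega> *v d)
      = (\<Sum>i\<in>UNIV. \<Sum>j\<in>UNIV. d $ i * d $ j * (2 * (\<omega> \<bullet> (partial_deriv i g x ** pinv (g x) ** partial_deriv j g x))))"
    using assms by (simp add: inner_vec_def[of d] matrix_vector_mult_def sigma_term_def mat_inner_eq
        sym_mats_def sum_distrib_left mult_ac)
  also have "\<dots> = 2 * (\<omega> \<bullet> (dir_deriv g x d ** pinv (g x) ** dir_deriv g x d))"
    by (simp add: dir_deriv_def matrix_mult.sum_left matrix_mult.sum_right matrix_mult.scaleR_left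
        matrix_mult.scaleR_right inner_sum_right sum_distrib_left mult_ac)
       (subst sum.swap, simp add: mult_ac)
  finally show ?thesis .
qed

lemma lagrangian_derivatives:
  fixes f :: "real ^ 'n \<Rightarrow> real" and g :: "real ^ 'n \<Rightarrow> real ^ 'm ^ 'm"
  assumes jf: "c2_jet f f1 f2" and jg: "c2_jet g g1 g2"
    and jh: "\<And>i. i < p \<Longrightarrow> c2_jet (h i) (h1 i) (h2 i)"
    and sym: "\<And>x. g x \<in> sym_mats"
  shows "(lagrangian f g p h \<omega> \<mu> has_derivative
      (\<lambda>v. f1 x v - \<omega> \<bullet> g1 x v + (\<Sum>i<p. \<mu> i * h1 i x v))) (at x)"
    and "d \<bullet> (hess (lagrangian f g p h \<omega> \<mu>) x *v d)
      = f2 x d d - \<omega> \<bullet> g2 x d d + (\<Sum>i<p. \<mu> i * h2 i x d d)"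
proof -
  have L: "lagrangian f g p h \<omega> \<mu> = (\<lambda>x. f x - \<omega> \<bullet> g x + (\<Sum>i<p. \<mu> i * h i x))"
    using sym by (simp add: fun_eq_iff lagrangian_def mat_inner_eq sym_mats_def inner_commute mult.commute)
  have D: "(f has_derivative f1 x) (at x)" "(g has_derivative g1 x) (at x)"
    "i < p \<Longrightarrow> (h i has_derivative h1 i x) (at x)" for x i
    using jf jg jh by (auto simp: c2_jet_def)
  show 1: "(lagrangian f g p h \<omega> \<mu> has_derivative
      (\<lambda>v. f1 x v - \<omega> \<bullet> g1 x v + (\<Sum>i<p. \<mu> i * h1 i x v))) (at x)" for x
    unfolding L by (intro derivative_intros D has_derivative_inner_right) auto
  show "d \<bullet> (hess (lagrangian f g p h \<omega> \<mu>) x *v d)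
      = f2 x d d - \<omega> \<bullet> g2 x d d + (\<Sum>i<p. \<mu> i * h2 i x d d)"
    by (rule hess_quadratic_form[OF 1])
       (intro derivative_intros has_derivative_inner_right c2_jet_apply_derivative[OF jf]
         c2_jet_apply_derivative[OF jg] c2_jet_apply_derivative[OF jh], auto)
qed

section \<open>Critical directions\<close>

lemma vbar_inner:
  fixes g :: "real ^ 'n \<Rightarrow> real ^ 'm ^ 'm"
  shows "vbar g UU i j x \<bullet> d = UU (g x) i \<bullet> (dir_deriv g x d *v UU (g x) j)"
  by (simp add: vbar_def dir_deriv_def inner_vec_def[of _ d] matrix_vector_mult.sum_left
      inner_sum_right scaleR_matrix_vector_assoc[symmetric] mult.commute)

lemma psd_upto_antisym:
  assumes "psd_upto b A" "psd_upto b (\<lambda>i j. - A i j)" "i < b" "j < b"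
  shows "A i j = 0"
proof -
  have sym: "A i j = A j i" using assms by (simp add: psd_upto_def)
  have q: "(\<Sum>i<b. \<Sum>j<b. z i * A i j * z j) = 0" for z
  proof -
    have "0 \<le> (\<Sum>i<b. \<Sum>j<b. z i * A i j * z j)" "0 \<le> (\<Sum>i<b. \<Sum>j<b. z i * (- A i j) * z j)"
      using assms(1,2) unfolding psd_upto_def by blast+
    then show ?thesis by (simp add: sum_negf)
  qed
  have pick: "(\<Sum>k<b. (if k = l then 1 else 0) * c k) = c l"
    "(\<Sum>k<b. c k * (if k = l then 1 else 0)) = c l" if "l < b" for l and c :: "nat \<Rightarrow> real"
    using that by (simp_all add: if_distrib[of "\<lambda>t. t * _"] if_distrib[of "\<lambda>t. _ * t"] cong: if_cong)
  have e: "(\<Sum>s<b. \<Sum>t<b. (if s = k then 1 else 0) * A s t * (if t = l then 1 else 0)) = A k l"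
    if "k < b" "l < b" for k l
    using that by (simp add: mult.assoc pick flip: sum_distrib_left)
  \<comment> \<open>polarization with the sum of the unit vectors \<open>i\<close> and \<open>j\<close>\<close>
  define z where "z = (\<lambda>k. (if k = i then 1 else 0) + (if k = j then 1 else 0) :: real)"
  have "0 = (\<Sum>s<b. \<Sum>t<b. z s * A s t * z t)" by (simp add: q)
  also have "\<dots> = A i i + A i j + A j i + A j j"
    unfolding z_def distrib_left distrib_right sum.distrib e[OF assms(3,3)] e[OF assms(3,4)]
      e[OF assms(4,3)] e[OF assms(4,4)] by simp
  also have "A i i = 0" using q[of "\<lambda>s. if s = i then 1 else 0"] e[OF assms(3,3)] by simp
  also have "A j j = 0" using q[of "\<lambda>s. if s = j then 1 else 0"] e[OF assms(4,4)] by simp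
  finally show ?thesis using sym by simp
qed

text \<open>
  Both \<open>d\<close> and \<open>- d\<close> lie in the critical cone, and a form that is positive semidefinite together
  with its negative is zero.
\<close>

lemma critical_subspace_equations:
  fixes g :: "real ^ 'n \<Rightarrow> real ^ 'm ^ 'm"
  assumes dg: "(g has_derivative g') (at x)" and d: "d \<in> critical_subspace f g p h b U x"
  shows "\<And>i. i < p \<Longrightarrow> grad (h i) x \<bullet> d = 0"
    and "\<And>i j. i < b \<Longrightarrow> j < b \<Longrightarrow> U i \<bullet> (g' d *v U j) = 0"
proof -
  have C: "d \<in> critical_cone f g p h b U x" "- d \<in> critical_cone f g p h b U x"
    using d by (auto simp: critical_subspace_def)
  show "grad (h i) x \<bullet> d = 0" if "i < p" for i
    using C that by (simp add: critical_cone_def)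
  have "g' (- d) = - g' d" by (rule linear_neg[OF has_derivative_linear[OF dg]])
  then have "psd_upto b (\<lambda>i j. U i \<bullet> (g' d *v U j))" "psd_upto b (\<lambda>i j. - (U i \<bullet> (g' d *v U j)))"
    using C by (auto simp: critical_cone_def dir_deriv_eq[OF dg] matrix_vector_mult.minus_left)
  then show "U i \<bullet> (g' d *v U j) = 0" if "i < b" "j < b" for i j
    using psd_upto_antisym[of b "\<lambda>i j. U i \<bullet> (g' d *v U j)"] that by blast
qed

text \<open>
  The direction \<open>d\<close> annihilates the family of the WCR property at \<open>x0\<close>; the constant rank yields
  nearby directions that annihilate the family at \<open>x k\<close>.
\<close>

lemma wcr_directions:
  fixes g :: "real ^ 'n \<Rightarrow> real ^ 'm ^ 'm" and x :: "nat \<Rightarrow> real ^ 'n"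
    and h :: "nat \<Rightarrow> real ^ 'n \<Rightarrow> real"
  assumes jg: "c2_jet g g1 g2" and jh: "\<And>i. i < p \<Longrightarrow> c2_jet (h i) (h1 i) (h2 i)"
    and sym: "\<And>y. g y \<in> sym_mats"
    and x: "x \<longlonglongrightarrow> x0" and u: "\<And>i. i < b \<Longrightarrow> (\<lambda>k. UU (g (x k)) i) \<longlonglongrightarrow> UU (g x0) i"
    and rank: "\<And>k. dim ({vbar g UU i j (x k) | i j. i \<le> j \<and> j < b} \<union> {grad (h i) (x k) | i. i < p})
        = dim ({vbar g UU i j x0 | i j. i \<le> j \<and> j < b} \<union> {grad (h i) x0 | i. i < p})"
    and dh: "\<And>i. i < p \<Longrightarrow> h1 i x0 d = 0"
    and dg: "\<And>i j. i < b \<Longrightarrow> j < b \<Longrightarrow> UU (g x0) i \<bullet> (g1 x0 d *v UU (g x0) j) = 0"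
  obtains v where "v \<longlonglongrightarrow> d" "\<And>k i. i < p \<Longrightarrow> h1 i (x k) (v k) = 0"
    "\<And>k i j. i < b \<Longrightarrow> j < b \<Longrightarrow> UU (g (x k)) i \<bullet> (g1 (x k) (v k) *v UU (g (x k)) j) = 0"
proof -
  have D: "(g has_derivative g1 y) (at y)" "i < p \<Longrightarrow> (h i has_derivative h1 i y) (at y)" for y i
    using jg jh by (auto simp: c2_jet_def)
  define J where "J = {(i, j). i \<le> j \<and> j < b}"
  \<comment> \<open>one index type for the two families of vectors\<close>
  define I where "I = Inl ` J \<union> Inr ` {..<p}"
  define a where "a = (\<lambda>y s. case s of Inl (i, j) \<Rightarrow> vbar g UU i j y | Inr i \<Rightarrow> grad (h i) y)"
  have "finite J" by (rule finite_subset[of _ "{..<b} \<times> {..<b}"]) (auto simp: J_def)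
  then have fI: "finite I" by (simp add: I_def)
  have aI: "a y ` I = {vbar g UU i j y | i j. i \<le> j \<and> j < b} \<union> {grad (h i) y | i. i < p}" for y
    unfolding I_def image_Un image_image a_def J_def by auto
  have lim: "(\<lambda>k. a (x k) s) \<longlonglongrightarrow> a x0 s" if "s \<in> I" for s
  proof -
    have v: "(\<lambda>k. vbar g UU i j (x k)) \<longlonglongrightarrow> vbar g UU i j x0" if "i < b" "j < b" for i j
    proof (intro vec_tendstoI)
      fix l
      have "(\<lambda>k. UU (g (x k)) i \<bullet> (g1 (x k) (axis l 1) *v UU (g (x k)) j))
          \<longlonglongrightarrow> UU (g x0) i \<bullet> (g1 x0 (axis l 1) *v UU (g x0) j)"
        by (intro tendsto_inner matrix_vector_mult.tendsto u that c2_jet_tendsto(2)[OF jg x] tendsto_const)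
      then show "(\<lambda>k. vbar g UU i j (x k) $ l) \<longlonglongrightarrow> vbar g UU i j x0 $ l"
        by (simp add: vbar_def partial_deriv_eq[OF D(1)])
    qed
    have w: "(\<lambda>k. grad (h i) (x k)) \<longlonglongrightarrow> grad (h i) x0" if "i < p" for i
    proof (intro vec_tendstoI)
      fix l
      have "(\<lambda>k. h1 i (x k) (axis l 1)) \<longlonglongrightarrow> h1 i x0 (axis l 1)"
        by (intro c2_jet_tendsto(2)[OF jh x] tendsto_const that)
      then show "(\<lambda>k. grad (h i) (x k) $ l) \<longlonglongrightarrow> grad (h i) x0 $ l"
        by (simp add: grad_def partial_deriv_eq[OF D(2)[OF that]])
    qed
    show ?thesis using that v w by (auto simp: I_def J_def a_def)
  qed
  have vb: "vbar g UU i j y \<bullet> e = UU (g y) i \<bullet> (g1 y e *v UU (g y) j)" for i j y e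
    by (simp add: vbar_inner dir_deriv_eq[OF D(1)])
  have gr: "grad (h i) y \<bullet> e = h1 i y e" if "i < p" for i y e
    by (rule grad_inner_eq[OF D(2)[OF that]])
  have zero: "a x0 s \<bullet> d = 0" if "s \<in> I" for s
    using that dh dg by (auto simp: I_def J_def a_def vb gr)
  have const: "\<forall>\<^sub>F k in sequentially. dim (a (x k) ` I) = dim (a x0 ` I)"
    unfolding aI using rank by simp
  obtain v where v: "v \<longlonglongrightarrow> d" "\<And>k s. s \<in> I \<Longrightarrow> a (x k) s \<bullet> v k = 0"
  proof (rule constant_rank_orthogonal_inner_limit[OF fI lim const zero])
  qed (assumption | rule that | blast)+
  show thesis
  proof (rule that[OF v(1)])
    show "h1 i (x k) (v k) = 0" if "i < p" for k i
      using v(2)[of "Inr i" k] that by (simp add: I_def a_def gr)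
    have le: "UU (g (x k)) i \<bullet> (g1 (x k) (v k) *v UU (g (x k)) j) = 0" if "i \<le> j" "j < b" for i j k
      using v(2)[of "Inl (i, j)" k] that by (simp add: I_def J_def a_def vb)
    fix k i j assume ij: "i < b" "j < b"
    have "g1 (x k) (v k) \<in> sym_mats" by (rule derivative_in_sym_mats[OF D(1) sym])
    then have "UU (g (x k)) i \<bullet> (g1 (x k) (v k) *v UU (g (x k)) j)
        = UU (g (x k)) j \<bullet> (g1 (x k) (v k) *v UU (g (x k)) i)"
      by (metis symmetric_inner_swap inner_commute)
    then show "UU (g (x k)) i \<bullet> (g1 (x k) (v k) *v UU (g (x k)) j) = 0"
      using le[of i j k] le[of j i k] ij by (cases "i \<le> j") auto
  qed
qed

section \<open>The weak second-order condition\<close>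

theorem theorem4p2:
  fixes f :: "real ^ 'n \<Rightarrow> real"
    and g :: "real ^ 'n \<Rightarrow> real ^ 'm ^ 'm"
    and p :: nat
    and h :: "nat \<Rightarrow> real ^ 'n \<Rightarrow> real"
    and x\<^sub>0 :: "real ^ 'n"
    and b :: nat
    and U :: "nat \<Rightarrow> real ^ 'm"
    and N\<^sub>0 :: "(real ^ 'm ^ 'm) set"
    and UU :: "real ^ 'm ^ 'm \<Rightarrow> nat \<Rightarrow> real ^ 'm"
  assumes "twice_cont_diff f"
    and "twice_cont_diff g" and "\<And>x. g x \<in> sym_mats"
    and "\<And>i. i < p \<Longrightarrow> twice_cont_diff (h i)"
    and "local_minimizer f g p h x\<^sub>0"
    and "b = dim (mat_ker (g x\<^sub>0))"
    and "orthonormal_basis b U (mat_ker (g x\<^sub>0))"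
    and "analytic_eigenbasis (g x\<^sub>0) b U N\<^sub>0 UU"
    and "robinson_cq g p h x\<^sub>0"
    and "wcr g p h b N\<^sub>0 UU x\<^sub>0"
  shows "\<exists>\<omega>\<in>psd_cone. \<exists>\<mu>. kkt f g p h x\<^sub>0 \<omega> \<mu> \<and> wsoc f g p h b U x\<^sub>0 \<omega> \<mu>"
proof -
  have sym: "\<And>x. g x \<in> sym_mats" by fact
  have ae: "analytic_eigenbasis (g x\<^sub>0) b U N\<^sub>0 UU" by fact
  obtain f1 f2 where jf: "c2_jet f f1 f2" using assms(1) unfolding twice_cont_diff_jet by blast
  obtain g1 g2 where jg: "c2_jet g g1 g2" using assms(2) unfolding twice_cont_diff_jet by blast
  have "\<forall>i. \<exists>h1 h2. i < p \<longrightarrow> c2_jet (h i) h1 h2" using assms(4) unfolding twice_cont_diff_jet by blast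
  then obtain h1 h2 where jh: "\<And>i. i < p \<Longrightarrow> c2_jet (h i) (h1 i) (h2 i)" by metis
  have Dg: "(g has_derivative g1 y) (at y)" and Dh: "i < p \<Longrightarrow> (h i has_derivative h1 i y) (at y)" for y i
    using jg jh by (auto simp: c2_jet_def)
  have feas: "feasible g p h x\<^sub>0" and gpsd: "g x\<^sub>0 \<in> psd_cone" and h0: "\<And>i. i < p \<Longrightarrow> h i x\<^sub>0 = 0"
    using assms(5) by (auto simp: local_minimizer_def feasible_def)
  obtain r0 where r0: "r0 > 0" "\<And>y. y \<in> ball x\<^sub>0 r0 \<Longrightarrow> feasible g p h y \<Longrightarrow> f x\<^sub>0 \<le> f y"
    using assms(5) unfolding local_minimizer_def by blast
  obtain N R where N: "open N" "x\<^sub>0 \<in> N" "g ` N \<subseteq> N\<^sub>0"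
    and rank: "\<And>x. x \<in> N \<Longrightarrow> dim ({vbar g UU i j x | i j. i \<le> j \<and> j < b} \<union> {grad (h i) x | i. i < p}) = R"
    using assms(10) unfolding wcr_def by blast
  obtain r1 where r1: "r1 > 0" "ball x\<^sub>0 r1 \<subseteq> N"
    using N by (meson open_contains_ball)
  define r where "r = min r0 r1"
  have r: "r > 0" "ball x\<^sub>0 r \<subseteq> N" using r0(1) r1 by (auto simp: r_def)
  have rmin: "f x\<^sub>0 \<le> f y" if "y \<in> ball x\<^sub>0 r" "g y \<in> psd_cone" "\<And>i. i < p \<Longrightarrow> h i y = 0" for y
    using r0(2)[of y] that by (auto simp: r_def feasible_def)
  obtain \<rho> x Y where \<rho>: "\<And>k::nat. \<rho> k > 0" and Y: "\<And>k. Y k \<in> psd_cone"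
    and xr: "\<And>k. x k \<in> ball x\<^sub>0 r" and x: "x \<longlonglongrightarrow> x\<^sub>0" and Ylim: "Y \<longlonglongrightarrow> g x\<^sub>0"
    and loc: "\<And>k. \<exists>\<epsilon>>0. \<forall>y\<in>ball (x k) \<epsilon>. \<forall>Z\<in>psd_cone \<inter> ball (Y k) \<epsilon>.
        penalized f g p h x\<^sub>0 (\<rho> k) (x k) (Y k) \<le> penalized f g p h x\<^sub>0 (\<rho> k) y Z"
  proof (rule penalty_minimizers_converge[OF c2_jet_continuous(1)[OF jf] c2_jet_continuous(1)[OF jg]
        c2_jet_continuous(1)[OF jh] closed_psd_cone gpsd h0 r(1) rmin])
  qed (assumption | rule that | blast)+
  have xN: "x k \<in> N" for k using xr r(2) by blast
  then have gN: "g (x k) \<in> N\<^sub>0" for k using N(3) by blast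
  have "\<exists>ev e. spectral_decomposition (g (x k)) ev e \<and>
      span (UU (g (x k)) ` {..<b}) = span (e ` {..<b})" for k
    using ae gN[of k] unfolding analytic_eigenbasis_def smallest_eigenspace_def orthonormal_basis_def
    by (metis (no_types, lifting))
  then obtain ev e where dec: "\<And>k. spectral_decomposition (g (x k)) (ev k) (e k)"
    and span: "\<And>k. span (UU (g (x k)) ` {..<b}) = span (e k ` {..<b})"
    by metis
  define \<omega> where "\<omega> = (\<lambda>k. \<rho> k *\<^sub>R (Y k - g (x k)))"
  define \<mu> where "\<mu> = (\<lambda>k i. \<rho> k * h i (x k))"
  define c where "c = (\<lambda>k d. f1 (x k) d + 4 * ((x k - x\<^sub>0) \<bullet> (x k - x\<^sub>0)) * ((x k - x\<^sub>0) \<bullet> d))"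
  have \<omega>psd: "\<omega> k \<in> psd_cone" for k
    unfolding \<omega>_def by (rule penalized_psd_optimality(1)[OF jf jg jh sym Y loc])
  then have \<omega>sym: "\<omega> k \<in> sym_mats" for k by (simp add: psd_cone_def)
  have stat: "c k d + (\<Sum>i<p. \<mu> k i * h1 i (x k) d) - \<omega> k \<bullet> g1 (x k) d = 0" for k d
    unfolding \<omega>_def \<mu>_def c_def by (rule penalized_psd_optimality(3)[OF jf jg jh sym Y loc])
  have pos: "0 \<le> \<omega> k \<bullet> Z" if "Z \<in> psd_cone" for k Z
    unfolding \<omega>_def by (rule penalized_spectral_optimality(1)[OF jf jg jh sym Y \<rho> loc dec that])
  have compl: "\<omega> k \<bullet> Y k = 0" for k
    unfolding \<omega>_def by (rule penalized_spectral_optimality(2)[OF jf jg jh sym Y \<rho> loc dec])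
  have clim: "(\<lambda>k. c k d) \<longlonglongrightarrow> f1 x\<^sub>0 d" for d
  proof -
    have "(\<lambda>k. c k d) \<longlonglongrightarrow> f1 x\<^sub>0 d + 4 * ((x\<^sub>0 - x\<^sub>0) \<bullet> (x\<^sub>0 - x\<^sub>0)) * ((x\<^sub>0 - x\<^sub>0) \<bullet> d)"
      unfolding c_def by (intro tendsto_intros c2_jet_tendsto(2)[OF jf x] x)
    then show ?thesis by simp
  qed
  obtain d0 where slater: "g x\<^sub>0 + g1 x\<^sub>0 d0 \<in> top_of_set sym_mats interior_of psd_cone"
      "\<And>i. i < p \<Longrightarrow> h1 i x\<^sub>0 d0 = 0"
    using assms(9) grad_inner_eq[OF Dh] unfolding robinson_cq_def dir_deriv_eq[OF Dg] by metis
  have indep: "\<forall>i<p. \<nu> i = 0" if z: "\<And>d. (\<Sum>i<p. \<nu> i * h1 i x\<^sub>0 d) = 0" for \<nu>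
  proof -
    have "(\<Sum>i<p. \<nu> i *\<^sub>R grad (h i) x\<^sub>0) \<bullet> d = 0" for d
      using z[of d] by (simp add: inner_sum_left grad_inner_eq[OF Dh])
    then have "(\<Sum>i<p. \<nu> i *\<^sub>R grad (h i) x\<^sub>0) = 0" by (metis inner_eq_zero_iff)
    then show ?thesis
      using full_rank_coefficients[of "\<lambda>i. grad (h i) x\<^sub>0"] assms(9) unfolding robinson_cq_def by blast
  qed
  obtain s \<omega>0 \<mu>0 where s: "strict_mono (s :: nat \<Rightarrow> nat)" and \<omega>s: "(\<lambda>k. \<omega> (s k)) \<longlonglongrightarrow> \<omega>0"
      and \<mu>s: "\<And>i. i < p \<Longrightarrow> (\<lambda>k. \<mu> (s k) i) \<longlonglongrightarrow> \<mu>0 i"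
  proof (rule multipliers_convergent_subsequence[OF jg jh x Ylim \<omega>sym pos compl clim stat indep slater])
  qed (assumption | rule that | blast)+
  have "bounded (range (\<lambda>k. e (s k) i))" if "i \<in> {..<CARD('m)}" for i
  proof (rule boundedI[of _ 1])
    fix y assume "y \<in> range (\<lambda>k. e (s k) i)"
    then obtain k where "y = e (s k) i" by auto
    then have "y \<bullet> y = 1"
      using dec[of "s k"] that by (simp add: spectral_decomposition_def orthonormal_basis_def)
    then show "norm y \<le> 1" by (simp add: norm_eq_sqrt_inner)
  qed
  then obtain t e0 where t: "strict_mono (t :: nat \<Rightarrow> nat)"
    and e0: "\<And>i. i < CARD('m) \<Longrightarrow> (\<lambda>k. e (s (t k)) i) \<longlonglongrightarrow> e0 i"
    using convergent_subsequence_finite_family[of "{..<CARD('m)}" "\<lambda>k. e (s k)"] by auto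
  \<comment> \<open>along \<open>q\<close> the multipliers and the eigenvectors of \<open>g (x k)\<close> both converge\<close>
  define q where "q = s \<circ> t"
  have q: "strict_mono q" unfolding q_def by (rule strict_mono_o[OF s t])
  have sub: "(\<lambda>k. z (q k)) \<longlonglongrightarrow> l" if "z \<longlonglongrightarrow> l" for z :: "nat \<Rightarrow> 'z::topological_space" and l
    using LIMSEQ_subseq_LIMSEQ[OF that q] by (simp add: o_def)
  have \<omega>q: "(\<lambda>k. \<omega> (q k)) \<longlonglongrightarrow> \<omega>0" and \<mu>q: "i < p \<Longrightarrow> (\<lambda>k. \<mu> (q k) i) \<longlonglongrightarrow> \<mu>0 i" for i
    using LIMSEQ_subseq_LIMSEQ[OF _ t] \<omega>s \<mu>s by (auto simp: o_def q_def)
  have eq: "(\<lambda>k. e (q k) i) \<longlonglongrightarrow> e0 i" if "i < CARD('m)" for i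
    using e0[OF that] by (simp add: q_def)
  have xq: "(\<lambda>k. x (q k)) \<longlonglongrightarrow> x\<^sub>0" by (rule sub[OF x])
  have gq: "(\<lambda>k. g (x (q k))) \<longlonglongrightarrow> g x\<^sub>0" by (rule c2_jet_tendsto(1)[OF jg xq tendsto_const])
  define ev0 where "ev0 = (\<lambda>i. e0 i \<bullet> (g x\<^sub>0 *v e0 i))"
  have evq: "i < CARD('m) \<Longrightarrow> (\<lambda>k. ev (q k) i) \<longlonglongrightarrow> ev0 i"
    and dec0: "spectral_decomposition (g x\<^sub>0) ev0 e0" for i
    unfolding ev0_def by (rule spectral_decomposition_limit[OF dec gq eq]; assumption?)+
  have ev0_zero: "ev0 i = 0" if "i < CARD('m)" "i < b" for i
    using psd_eigenvalues_kernel(1)[OF dec0 gpsd] that assms(6) by simp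
  have ev0_pos: "ev0 i > 0" if "i < CARD('m)" "b \<le> i" for i
    using psd_eigenvalues_kernel(2)[OF dec0 gpsd] that assms(6) by simp
  have pinv: "pinv (g x\<^sub>0) = spectral_matrix e0 (\<lambda>i. inverse (ev0 i))"
    using dec0 pinv_spectral_matrix[of e0 ev0] spectral_decomposition_eq_spectral_matrix[OF dec0]
    by (simp add: spectral_decomposition_def)
  define X where "X = (\<lambda>k. spectral_matrix (e k) (\<lambda>i. if i < b then 0 else inverse (ev k i)))"
  have Xq: "(\<lambda>k. X (q k)) \<longlonglongrightarrow> pinv (g x\<^sub>0)"
    unfolding X_def pinv
  proof (rule tendsto_spectral_matrix[OF eq])
    fix i assume i: "i < CARD('m)"
    show "(\<lambda>k. if i < b then 0 else inverse (ev (q k) i)) \<longlonglongrightarrow> inverse (ev0 i)"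
    proof (cases "i < b")
      case False
      then have "ev0 i \<noteq> 0" using ev0_pos[OF i] by simp
      then show ?thesis using False tendsto_inverse[OF evq[OF i]] by simp
    qed (simp add: ev0_zero[OF i])
  qed
  have ev_pos: "\<forall>\<^sub>F k in sequentially. \<forall>i\<in>{b..<CARD('m)}. 0 < ev (q k) i"
  proof (rule eventually_ball_finite)
    show "\<forall>i\<in>{b..<CARD('m)}. \<forall>\<^sub>F k in sequentially. 0 < ev (q k) i"
      using order_tendstoD(1)[OF evq ev0_pos] by simp
  qed simp
  have \<omega>0psd: "\<omega>0 \<in> psd_cone"
    by (rule closed_sequentially[OF closed_psd_cone _ \<omega>q]) (rule \<omega>psd)
  then have \<omega>0sym: "\<omega>0 \<in> sym_mats" by (simp add: psd_cone_def)
  have stat0: "f1 x\<^sub>0 d - \<omega>0 \<bullet> g1 x\<^sub>0 d + (\<Sum>i<p. \<mu>0 i * h1 i x\<^sub>0 d) = 0" for d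
  proof -
    have "(\<lambda>k. c (q k) d + (\<Sum>i<p. \<mu> (q k) i * h1 i (x (q k)) d) - \<omega> (q k) \<bullet> g1 (x (q k)) d)
       \<longlonglongrightarrow> f1 x\<^sub>0 d + (\<Sum>i<p. \<mu>0 i * h1 i x\<^sub>0 d) - \<omega>0 \<bullet> g1 x\<^sub>0 d"
      by (intro tendsto_intros sub[OF clim] \<mu>q \<omega>q c2_jet_tendsto(2)[OF jg xq] c2_jet_tendsto(2)[OF jh xq]) auto
    then show ?thesis unfolding stat by (simp add: LIMSEQ_const_iff)
  qed
  have "\<omega>0 \<bullet> g x\<^sub>0 = 0"
    using tendsto_inner[OF \<omega>q sub[OF Ylim]] by (simp add: compl LIMSEQ_const_iff)
  then have compl0: "mat_inner (g x\<^sub>0) \<omega>0 = 0"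
    using sym[of x\<^sub>0] by (simp add: mat_inner_eq sym_mats_def inner_commute)
  have L1: "(lagrangian f g p h \<omega>0 \<mu>0 has_derivative
      (\<lambda>v. f1 x\<^sub>0 v - \<omega>0 \<bullet> g1 x\<^sub>0 v + (\<Sum>i<p. \<mu>0 i * h1 i x\<^sub>0 v))) (at x\<^sub>0)"
    by (rule lagrangian_derivatives(1)[OF jf jg jh sym])
  have L2: "d \<bullet> (hess (lagrangian f g p h \<omega>0 \<mu>0) x\<^sub>0 *v d)
      = f2 x\<^sub>0 d d - \<omega>0 \<bullet> g2 x\<^sub>0 d d + (\<Sum>i<p. \<mu>0 i * h2 i x\<^sub>0 d d)" for d
    by (rule lagrangian_derivatives(2)[OF jf jg jh sym])
  have "grad (lagrangian f g p h \<omega>0 \<mu>0) x\<^sub>0 \<bullet> d = 0" for d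
    unfolding grad_inner_eq[OF L1] by (rule stat0)
  then have "grad (lagrangian f g p h \<omega>0 \<mu>0) x\<^sub>0 = 0" by (metis inner_eq_zero_iff)
  with feas \<omega>0psd compl0 have kkt: "kkt f g p h x\<^sub>0 \<omega>0 \<mu>0" by (simp add: kkt_def)
  have "wsoc f g p h b U x\<^sub>0 \<omega>0 \<mu>0"
    unfolding wsoc_def
  proof
    fix d assume d: "d \<in> critical_subspace f g p h b U x\<^sub>0"
    have UU0: "UU (g x\<^sub>0) i = U i" if "i < b" for i using ae that by (simp add: analytic_eigenbasis_def)
    have uq: "(\<lambda>k. UU (g (x (q k))) i) \<longlonglongrightarrow> UU (g x\<^sub>0) i" if "i < b" for i
      using analytic_eigenbasis_tendsto[OF ae that gq gN] UU0[OF that] by simp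
    have dh: "h1 i x\<^sub>0 d = 0" if "i < p" for i
      using critical_subspace_equations(1)[OF Dg d that] grad_inner_eq[OF Dh[OF that]] by simp
    have dg: "UU (g x\<^sub>0) i \<bullet> (g1 x\<^sub>0 d *v UU (g x\<^sub>0) j) = 0" if "i < b" "j < b" for i j
      using critical_subspace_equations(2)[OF Dg d that] by (simp add: UU0 that)
    have rk: "dim ({vbar g UU i j (x (q k)) | i j. i \<le> j \<and> j < b} \<union> {grad (h i) (x (q k)) | i. i < p})
        = dim ({vbar g UU i j x\<^sub>0 | i j. i \<le> j \<and> j < b} \<union> {grad (h i) x\<^sub>0 | i. i < p})" for k
      by (simp only: rank[OF xN] rank[OF N(2)])
    obtain v where v: "v \<longlonglongrightarrow> d" and vh: "\<And>k i. i < p \<Longrightarrow> h1 i (x (q k)) (v k) = 0"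
      and vg: "\<And>k i j. i < b \<Longrightarrow> j < b \<Longrightarrow>
          UU (g (x (q k))) i \<bullet> (g1 (x (q k)) (v k) *v UU (g (x (q k))) j) = 0"
    proof (rule wcr_directions[OF jg jh sym xq uq rk dh dg])
    qed (assumption | rule that | blast)+
    \<comment> \<open>the second-order condition at \<open>x (q k)\<close> in direction \<open>v k\<close>, whose limit is the claim\<close>
    define F where "F = (\<lambda>k. f2 (x (q k)) (v k) (v k) + 8 * ((x (q k) - x\<^sub>0) \<bullet> v k)\<^sup>2
        + 4 * ((x (q k) - x\<^sub>0) \<bullet> (x (q k) - x\<^sub>0)) * (v k \<bullet> v k)
        + (\<Sum>i<p. \<mu> (q k) i * h2 i (x (q k)) (v k) (v k)) - \<omega> (q k) \<bullet> g2 (x (q k)) (v k) (v k)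
        + 2 * (\<omega> (q k) \<bullet> (g1 (x (q k)) (v k) ** X (q k) ** g1 (x (q k)) (v k))))"
    have "\<forall>\<^sub>F k in sequentially. 0 \<le> F k"
      using ev_pos
    proof eventually_elim
      case (elim k)
      have block: "e (q k) i \<bullet> (g1 (x (q k)) (v k) *v e (q k) j) = 0" if "i < b" "j < b" for i j
      proof (rule bilinear_vanishes_on_spans[of "UU (g (x (q k))) ` {..<b}"])
        show "e (q k) i \<in> span (UU (g (x (q k))) ` {..<b})" "e (q k) j \<in> span (UU (g (x (q k))) ` {..<b})"
          unfolding span using that by (auto intro: span_base)
      qed (use vg in auto)
      show ?case
        unfolding F_def \<omega>_def \<mu>_def X_def
        by (rule penalized_spectral_optimality(3)[OF jf jg jh sym Y \<rho> loc dec])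
           (use elim vh block in auto)
    qed
    moreover have "F \<longlonglongrightarrow> f2 x\<^sub>0 d d + 8 * ((x\<^sub>0 - x\<^sub>0) \<bullet> d)\<^sup>2
        + 4 * ((x\<^sub>0 - x\<^sub>0) \<bullet> (x\<^sub>0 - x\<^sub>0)) * (d \<bullet> d)
        + (\<Sum>i<p. \<mu>0 i * h2 i x\<^sub>0 d d) - \<omega>0 \<bullet> g2 x\<^sub>0 d d
        + 2 * (\<omega>0 \<bullet> (g1 x\<^sub>0 d ** pinv (g x\<^sub>0) ** g1 x\<^sub>0 d))"
      unfolding F_def
      by (intro tendsto_intros matrix_mult.tendsto Xq xq v \<mu>q \<omega>q c2_jet_tendsto(2,3)[OF jf xq v]
          c2_jet_tendsto(2,3)[OF jg xq v] c2_jet_tendsto(2,3)[OF jh xq v]) auto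
    ultimately have "0 \<le> f2 x\<^sub>0 d d + (\<Sum>i<p. \<mu>0 i * h2 i x\<^sub>0 d d) - \<omega>0 \<bullet> g2 x\<^sub>0 d d
        + 2 * (\<omega>0 \<bullet> (g1 x\<^sub>0 d ** pinv (g x\<^sub>0) ** g1 x\<^sub>0 d))"
      using tendsto_lowerbound[of F _ sequentially 0] by simp
    also have "\<dots> = d \<bullet> (hess (lagrangian f g p h \<omega>0 \<mu>0) x\<^sub>0 *v d) + d \<bullet> (sigma_term g x\<^sub>0 \<omega>0 *v d)"
      by (simp add: L2 sigma_term_quadratic_form[OF \<omega>0sym]
          dir_deriv_eq[OF Dg])
    also have "\<dots> = d \<bullet> ((hess (lagrangian f g p h \<omega>0 \<mu>0) x\<^sub>0 + sigma_term g x\<^sub>0 \<omega>0) *v d)"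
      by (simp add: matrix_vector_mult_add_rdistrib inner_add_right)
    finally show "0 \<le> d \<bullet> ((hess (lagrangian f g p h \<omega>0 \<mu>0) x\<^sub>0 + sigma_term g x\<^sub>0 \<omega>0) *v d)" .
  qed
  with kkt \<omega>0psd show ?thesis by blast
qed

end
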